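(* Let $X$ be a compact (connected, positive-dimensional) homogeneous Riemannian manifold endowed with a left-invariant metric $g$, let $\mathsf{d}_g$ be the associated distance function, and let $$\mu_{\mathrm{w},g}:=\frac{\mathrm{dvol}_g}{\int_{x\in X}e^{-\mathsf{d}_g(x,y)}\,\mathrm{dvol}_g(x)}$$ be the associated weight measure (the denominator is independent of $y\in X$). Then, for each $N\in\mathbb{Z}_{>0}$, $$\mathrm{Mag}(X,\mathsf{d}_g,\mu_{\mathrm{w},g},\Gamma^{\mathrm{triv}};N)=\begin{cases}\mu_{\mathrm{w},g}(X)&\text{if } N\text{ is even},\\ 0&\text{if }N\text{ is odd},\end{cases}$$ where $$\mu_{\mathrm{w},g}(X)=\frac{\mathrm{Vol}_g(X)}{\int_{x\in X}e^{-\mathsf{d}_g(x,y)}\,\mathrm{dvol}_g(x)}.$$ Moreover, for any $0<c<1$, $$\mathrm{Mag}(X,\mathsf{d}_g,c\cdot\mu_{\mathrm{w},g},\Gamma^{\mathrm{triv}})=\frac{c}{1+c}\,\mu_{\mathrm{w},g}(X).$$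
   Context: Homogeneous means that the isometry group of $(X,g)$ acts transitively on $X$; $\mathrm{dvol}_g$ is the Riemannian volume measure and $\mathrm{Vol}_g(X)=\int_X\mathrm{dvol}_g$. For $n\ge 1$, $P_n(X):=\{(x_0,\dots,x_n)\in X^{n+1}\mid x_{k-1}\ne x_k \text{ for } k=1,\dots,n\}$. Let $\Omega_{x,y}$ be the set of non-constant length-minimising geodesics from $x$ to $y$ (empty if $x=y$). $\Gamma^{\mathrm{triv}}_{x,y}$ is the measure on $\{\emptyset,\Omega_{x,y}\}$ with $\Gamma^{\mathrm{triv}}_{x,y}(\Omega_{x,y})=1$ if $\Omega_{x,y}\neq\emptyset$. For $\bm{x}\in P_n(X)$, $\Omega_{\bm{x}}=\prod_{k=1}^n\Omega_{x_{k-1},x_k}$ carries the product measure $\Gamma^{\mathrm{triv}}_{\bm{x}}$, and $\mathrm{Len}(\gamma)=\sum_{k=1}^n\mathsf{d}(x_{k-1},x_k)$ for $\gamma\in\Omega_{\bm{x}}$. For a Borel measure $\mu$ with $\mu(X)<\infty$, $$\mathrm{Mag}(X,\mathsf{d},\mu,\Gamma^{\mathrm{triv}};N):=\mu(X)+\sum_{n=1}^N(-1)^n\int_{P_n(X)}\Big(\int_{\Omega_{\bm{x}}}e^{-\mathrm{Len}(\gamma)}\,\mathrm{d}\Gamma^{\mathrm{triv}}_{\bm{x}}\Big)\mathrm{d}\mu^{n+1},$$ with $\mu^{n+1}$ the product measure, and $\mathrm{Mag}(X,\mathsf{d},\mu,\Gamma^{\mathrm{triv}})$ is the limit as $N\to\infty$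 when it exists in $\mathbb{R}\cup\{\pm\infty\}$. *)

theory Defs
  imports "HOL-Probability.Probability"
begin

text \<open>Smooth maps between normed spaces; only ever used on open sets \<open>S\<close>.\<close>

primrec Ck_on :: "nat \<Rightarrow> 'e::real_normed_vector set \<Rightarrow> ('e \<Rightarrow> 'f::real_normed_vector) \<Rightarrow> bool" where
  "Ck_on 0 S f \<longleftrightarrow> continuous_on S f"
| "Ck_on (Suc k) S f \<longleftrightarrow>
     (\<forall>x\<in>S. f differentiable (at x)) \<and>
     (\<forall>v. Ck_on k S (\<lambda>x. frechet_derivative f (at x) v))"

definition smooth_on :: "'e::real_normed_vector set \<Rightarrow> ('e \<Rightarrow> 'f::real_normed_vector) \<Rightarrow> bool" where
  "smooth_on S f \<longleftrightarrow> (\<forall>k. Ck_on k S f)"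

definition jacobian :: "(real ^ 'n \<Rightarrow> real ^ 'n) \<Rightarrow> real ^ 'n \<Rightarrow> real ^ 'n ^ 'n" where
  "jacobian f x = matrix (frechet_derivative f (at x))"

text \<open>
  The underlying space of a manifold is a whole type \<open>'a\<close>, Hausdorff and second countable by its
  sort.  The model space is \<open>real ^ 'n\<close>, of dimension \<open>CARD('n) \<ge> 1\<close>, so manifolds are automatically
  positive-dimensional.  A chart is a pair of its domain and its coordinate map (whose values outside
  the domain are irrelevant).
\<close>

type_synonym ('a, 'n) chart = "'a set \<times> ('a \<Rightarrow> real ^ 'n)"

abbreviation chart_inv :: "('a, 'n) chart \<Rightarrow> real ^ 'n \<Rightarrow> 'a" where
  "chart_inv c \<equiv> inv_into (fst c) (snd c)"

definition is_chart :: "('a::topological_space, 'n::finite) chart \<Rightarrow> bool" where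
  "is_chart c \<longleftrightarrow>
     open (fst c) \<and> open (snd c ` fst c) \<and> inj_on (snd c) (fst c) \<and>
     homeomorphism (fst c) (snd c ` fst c) (snd c) (chart_inv c)"

definition local_rep :: "('a, 'n) chart \<Rightarrow> ('a, 'n) chart \<Rightarrow> ('a \<Rightarrow> 'a) \<Rightarrow> real ^ 'n \<Rightarrow> real ^ 'n" where
  "local_rep c c' f = snd c' \<circ> f \<circ> chart_inv c"

definition smooth_map :: "('a::topological_space, 'n::finite) chart set \<Rightarrow> ('a \<Rightarrow> 'a) \<Rightarrow> bool" where
  "smooth_map A f \<longleftrightarrow>
     continuous_on UNIV f \<and>
     (\<forall>c\<in>A. \<forall>c'\<in>A. smooth_on (snd c ` (fst c \<inter> f -` fst c')) (local_rep c c' f))"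

definition smooth_atlas :: "('a::topological_space, 'n::finite) chart set \<Rightarrow> bool" where
  "smooth_atlas A \<longleftrightarrow>
     (\<forall>c\<in>A. is_chart c) \<and> (\<Union>c\<in>A. fst c) = UNIV \<and>
     (\<forall>c\<in>A. \<forall>c'\<in>A. smooth_on (snd c ` (fst c \<inter> fst c')) (local_rep c c' id))"

text \<open>
  A Riemannian metric is given by its coordinate matrices: \<open>g c p\<close> is the matrix \<open>(g\<^sub>i\<^sub>j(p))\<close> in the
  chart \<open>c\<close>, subject to the transformation rule of covariant 2-tensors.
\<close>

type_synonym ('a, 'n) metric_tensor = "('a, 'n) chart \<Rightarrow> 'a \<Rightarrow> real ^ 'n ^ 'n"

definition riemannian_metric ::
  "('a::topological_space, 'n::finite) chart set \<Rightarrow> ('a, 'n) metric_tensor \<Rightarrow> bool" where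
  "riemannian_metric A g \<longleftrightarrow>
     (\<forall>c\<in>A. \<forall>p\<in>fst c. transpose (g c p) = g c p \<and> (\<forall>v. v \<noteq> 0 \<longrightarrow> v \<bullet> (g c p *v v) > 0)) \<and>
     (\<forall>c\<in>A. \<forall>i j. smooth_on (snd c ` fst c) (\<lambda>x. g c (chart_inv c x) $ i $ j)) \<and>
     (\<forall>c\<in>A. \<forall>c'\<in>A. \<forall>p\<in>fst c \<inter> fst c'.
        let J = jacobian (local_rep c c' id) (snd c p)
        in g c p = transpose J ** g c' p ** J)"

definition riemannian_isometry ::
  "('a::topological_space, 'n::finite) chart set \<Rightarrow> ('a, 'n) metric_tensor \<Rightarrow> ('a \<Rightarrow> 'a) \<Rightarrow> bool" where
  "riemannian_isometry A g f \<longleftrightarrow>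
     bij f \<and> smooth_map A f \<and> smooth_map A (inv f) \<and>
     (\<forall>c\<in>A. \<forall>c'\<in>A. \<forall>p\<in>fst c \<inter> f -` fst c'.
        let J = jacobian (local_rep c c' f) (snd c p)
        in g c p = transpose J ** g c' (f p) ** J)"

definition homogeneous ::
  "('a::topological_space, 'n::finite) chart set \<Rightarrow> ('a, 'n) metric_tensor \<Rightarrow> bool" where
  "homogeneous A g \<longleftrightarrow> (\<forall>x y. \<exists>f. riemannian_isometry A g f \<and> f x = y)"

definition C1_curve_on ::
  "('a::topological_space, 'n::finite) chart set \<Rightarrow> real \<Rightarrow> real \<Rightarrow> (real \<Rightarrow> 'a) \<Rightarrow> bool" where
  "C1_curve_on A a b \<gamma> \<longleftrightarrow>
     continuous_on {a..b} \<gamma> \<and>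
     (\<forall>c\<in>A. \<exists>v. continuous_on ({a..b} \<inter> \<gamma> -` fst c) v \<and>
        (\<forall>t\<in>{a..b} \<inter> \<gamma> -` fst c.
           ((snd c \<circ> \<gamma>) has_vector_derivative v t) (at t within {a..b})))"

definition piecewise_C1_curve ::
  "('a::topological_space, 'n::finite) chart set \<Rightarrow> (real \<Rightarrow> 'a) \<Rightarrow> bool" where
  "piecewise_C1_curve A \<gamma> \<longleftrightarrow>
     (\<exists>m (\<tau> :: nat \<Rightarrow> real). \<tau> 0 = 0 \<and> \<tau> m = 1 \<and>
        (\<forall>i<m. \<tau> i < \<tau> (Suc i) \<and> C1_curve_on A (\<tau> i) (\<tau> (Suc i)) \<gamma>))"

text \<open>
  The speed does not depend on the chart wherever the curve is differentiable, i.e. off a finite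
  set of parameters, which does not affect the length.
\<close>

definition curve_speed ::
  "('a, 'n::finite) chart set \<Rightarrow> ('a, 'n) metric_tensor \<Rightarrow> (real \<Rightarrow> 'a) \<Rightarrow> real \<Rightarrow> real" where
  "curve_speed A g \<gamma> t =
     (let c = (SOME c. c \<in> A \<and> \<gamma> t \<in> fst c);
          w = vector_derivative (snd c \<circ> \<gamma>) (at t)
      in sqrt (w \<bullet> (g c (\<gamma> t) *v w)))"

definition curve_length ::
  "('a, 'n::finite) chart set \<Rightarrow> ('a, 'n) metric_tensor \<Rightarrow> (real \<Rightarrow> 'a) \<Rightarrow> real" where
  "curve_length A g \<gamma> = integral {0..1} (curve_speed A g \<gamma>)"

definition riemannian_dist ::
  "('a::topological_space, 'n::finite) chart set \<Rightarrow> ('a, 'n) metric_tensor \<Rightarrow> 'a \<Rightarrow> 'a \<Rightarrow> real" where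
  "riemannian_dist A g x y =
     Inf {curve_length A g \<gamma> |\<gamma>. piecewise_C1_curve A \<gamma> \<and> \<gamma> 0 = x \<and> \<gamma> 1 = y}"

text \<open>The unique Borel measure with density \<open>sqrt (det (g\<^sub>i\<^sub>j))\<close> in every chart.\<close>

definition riemannian_volume ::
  "('a::topological_space, 'n::finite) chart set \<Rightarrow> ('a, 'n) metric_tensor \<Rightarrow> 'a measure" where
  "riemannian_volume A g =
     (THE M. sets M = sets borel \<and>
        (\<forall>c\<in>A. \<forall>B\<in>sets borel. B \<subseteq> fst c \<longrightarrow>
           emeasure M B =
             (\<integral>\<^sup>+x\<in>snd c ` B. ennreal (sqrt (det (g c (chart_inv c x)))) \<partial>lborel)))"

text \<open>
  Minimising geodesics of a metric space: curves parametrised on \<open>[0,1]\<close> proportionally to arc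
  length (and \<open>undefined\<close> outside \<open>[0,1]\<close>) that realise the distance.
\<close>

definition geodesics :: "('a \<Rightarrow> 'a \<Rightarrow> real) \<Rightarrow> 'a \<Rightarrow> 'a \<Rightarrow> (real \<Rightarrow> 'a) set" where
  "geodesics d x y =
     {\<gamma> \<in> extensional {0..1}. \<gamma> 0 = x \<and> \<gamma> 1 = y \<and>
        (\<exists>t\<in>{0..1}. \<gamma> t \<noteq> x) \<and>
        (\<forall>s\<in>{0..1}. \<forall>t\<in>{0..1}. d (\<gamma> s) (\<gamma> t) = \<bar>s - t\<bar> * d x y)}"

definition triv_measure :: "('a \<Rightarrow> 'a \<Rightarrow> real) \<Rightarrow> 'a \<Rightarrow> 'a \<Rightarrow> (real \<Rightarrow> 'a) measure" where
  "triv_measure d x y =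
     measure_of (geodesics d x y) {{}, geodesics d x y} (\<lambda>B. if B = {} then 0 else 1)"

definition paths :: "nat \<Rightarrow> (nat \<Rightarrow> 'a) set" where
  "paths n = {x \<in> {0..n} \<rightarrow>\<^sub>E UNIV. \<forall>k\<in>{1..n}. x (k - 1) \<noteq> x k}"

text \<open>
  The length of any tuple of minimising geodesics joining the consecutive points of \<open>x\<close>; it depends
  on the tuple only through \<open>x\<close>.
\<close>

definition path_len :: "('a \<Rightarrow> 'a \<Rightarrow> real) \<Rightarrow> nat \<Rightarrow> (nat \<Rightarrow> 'a) \<Rightarrow> real" where
  "path_len d n x = (\<Sum>k=1..n. d (x (k - 1)) (x k))"

definition magnitude_upto ::
  "('a \<Rightarrow> 'a \<Rightarrow> real) \<Rightarrow> 'a measure \<Rightarrow> ('a \<Rightarrow> 'a \<Rightarrow> (real \<Rightarrow> 'a) measure) \<Rightarrow> nat \<Rightarrow> real" where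
  "magnitude_upto d \<mu> \<Gamma> N =
     measure \<mu> (space \<mu>) +
     (\<Sum>n=1..N. (-1) ^ n *
        (LINT x:paths n|(\<Pi>\<^sub>M k\<in>{0..n}. \<mu>).
           (LINT \<gamma>|(\<Pi>\<^sub>M k\<in>{1..n}. \<Gamma> (x (k - 1)) (x k)). exp (- path_len d n x))))"

definition has_magnitude ::
  "('a \<Rightarrow> 'a \<Rightarrow> real) \<Rightarrow> 'a measure \<Rightarrow> ('a \<Rightarrow> 'a \<Rightarrow> (real \<Rightarrow> 'a) measure) \<Rightarrow> ereal \<Rightarrow> bool" where
  "has_magnitude d \<mu> \<Gamma> L \<longleftrightarrow> (\<lambda>N. ereal (magnitude_upto d \<mu> \<Gamma> N)) \<longlonglongrightarrow> L"

definition weight_denom ::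
  "('a::topological_space, 'n::finite) chart set \<Rightarrow> ('a, 'n) metric_tensor \<Rightarrow> 'a \<Rightarrow> real" where
  "weight_denom A g y = (LINT x|riemannian_volume A g. exp (- riemannian_dist A g x y))"

text \<open>
  On a homogeneous manifold the denominator, hence the weight measure, does not depend on the base
  point \<open>y\<close>.
\<close>

definition weight_measure ::
  "('a::topological_space, 'n::finite) chart set \<Rightarrow> ('a, 'n) metric_tensor \<Rightarrow> 'a \<Rightarrow> 'a measure" where
  "weight_measure A g y =
     scale_measure (ennreal (1 / weight_denom A g y)) (riemannian_volume A g)"

end

(*
  The weight measure \<mu> satisfies \<integral> exp (- d x y) d\<mu>(x) = 1 for every y, so integrating out the last
  point of a path turns the n-th integral of the magnitude into the (n - 1)-st one: for c \<mu> it
  equals c^(n + 1) \<mu>(X), and the partial sums are geometric.  Three facts make this work: points are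
  null sets, so the condition that consecutive points differ is harmless; distinct points are joined
  by a minimising geodesic, so the trivial measure of the geodesics has total mass 1; and the
  denominator of the weight measure is independent of the base point, because isometries preserve
  the volume and do not increase the distance.

  Minimising geodesics are obtained metrically.  A curve of almost minimal length gives, by
  compactness, points at any prescribed intermediate distance; a maximal isometric partial
  parametrisation of [0, 1] from x to y (Zorn) is then defined everywhere.

  The length of a piecewise C1 curve is handled through an inductively defined relation, built from
  C1 pieces by concatenation, so that the invariance statements only have to be checked on C1 pieces.
*)
theory Submission
  imports Defs
begin

section \<open>Magnitude of a measure with constant potential\<close>

text \<open>The integrals over paths are evaluated in \<open>ennreal\<close>, where Tonelli asks for
  no integrability, and only the closed form is carried over to the reals. Two definitions shape the
  geometry. The distance is a real \<open>Inf\<close>, informative only if some curve joins the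
  points, and this is where connectedness enters. The volume is a \<open>THE\<close>, so nothing can
  be said of it before a measure with the prescribed chart densities is built and shown to be
  unique. Independence of charts and invariance under isometries are one calculation: the identity
  is an isometry, so transformation lemmas are stated for isometries and specialised to
  \<open>id\<close>. Homogeneity enters through the denominator of the weight measure. Both claims
  on the magnitude come from one formula for the measure scaled by \<open>c\<close>:
  \<open>c = 1\<close> gives the alternating sum, \<open>c < 1\<close> a convergent geometric
  series.\<close>

lemma triv_measure_eq_return:
  assumes "\<gamma> \<in> geodesics d x y"
  shows "triv_measure d x y = return (sigma (geodesics d x y) {{}, geodesics d x y}) \<gamma>"
proof -
  let ?G = "geodesics d x y"
  let ?R = "return (sigma ?G {{}, ?G}) \<gamma>"
  have sig: "sigma_sets ?G {{}, ?G} = {{}, ?G}"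
    by (rule sigma_algebra.sigma_sets_eq[OF sigma_algebra_trivial])
  \<comment> \<open>On these two sets the function agrees with a Dirac mass, so the measure axioms
    are inherited; \<open>measure_of\<close> applied to a function violating them would be the zero
    measure.\<close>
  have "measure_of ?G {{}, ?G} (\<lambda>B. if B = {} then 0 else 1) =
      measure_of ?G {{}, ?G} (emeasure ?R)"
    using assms by (intro measure_of_eq) (auto simp: sig indicator_def)
  also have "\<dots> = measure_of (space ?R) (sets ?R) (emeasure ?R)"
    by (simp add: sig)
  finally show ?thesis
    by (simp only: triv_measure_def measure_of_of_measure)
qed

lemma prob_space_triv_measure:
  assumes "geodesics d x y \<noteq> {}"
  shows "prob_space (triv_measure d x y)"
proof -
  obtain \<gamma> where "\<gamma> \<in> geodesics d x y"
    using assms by auto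
  then show ?thesis
    using triv_measure_eq_return[of \<gamma> d x y] by (simp add: prob_space_return)
qed

lemma paths_Suc_upd:
  assumes "x \<in> {0..n} \<rightarrow>\<^sub>E UNIV"
  shows "x(Suc n := y) \<in> paths (Suc n) \<longleftrightarrow> x \<in> paths n \<and> y \<noteq> x n"
proof -
  have "{1..Suc n} = insert (Suc n) {1..n}"
    by auto
  moreover have "x(Suc n := y) \<in> {0..Suc n} \<rightarrow>\<^sub>E UNIV"
    using assms by (auto simp: PiE_iff extensional_def)
  ultimately show ?thesis
    using assms by (auto simp: paths_def)
qed

lemma path_len_Suc_upd: "path_len d (Suc n) (x(Suc n := y)) = path_len d n x + d (x n) y"
  by (auto simp: path_len_def intro!: sum.cong)

lemma path_step_measurable:
  fixes d :: "'a \<Rightarrow> 'a \<Rightarrow> real" and k n :: nat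
  assumes "case_prod d \<in> borel_measurable (M \<Otimes>\<^sub>M M)" "k \<in> {1..n}"
  shows "(\<lambda>x. d (x (k - 1)) (x k)) \<in> borel_measurable (\<Pi>\<^sub>M k\<in>{0..n}. M)"
proof -
  have "(\<lambda>x. x (k - 1)) \<in> measurable (\<Pi>\<^sub>M k\<in>{0..n}. M) M"
    "(\<lambda>x. x k) \<in> measurable (\<Pi>\<^sub>M k\<in>{0..n}. M) M"
    using assms(2) by (auto intro!: measurable_component_singleton)
  from measurable_compose[OF measurable_Pair[OF this] assms(1)] show ?thesis
    by simp
qed

lemma path_len_measurable:
  assumes "case_prod d \<in> borel_measurable (M \<Otimes>\<^sub>M M)"
  shows "path_len d n \<in> borel_measurable (\<Pi>\<^sub>M k\<in>{0..n}. M)"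
  unfolding path_len_def by (intro borel_measurable_sum path_step_measurable assms)

text \<open>\<open>d0\<close> trades the condition that two points differ for the nonvanishing of a
  real function, so the measurability of \<open>d\<close> settles that of the set.\<close>

lemma paths_measurable:
  fixes d :: "'a \<Rightarrow> 'a \<Rightarrow> real"
  assumes meas: "case_prod d \<in> borel_measurable (M \<Otimes>\<^sub>M M)"
    and d0: "\<And>x y. d x y = 0 \<longleftrightarrow> x = y" and sp: "space M = UNIV"
  shows "paths n \<in> sets (\<Pi>\<^sub>M k\<in>{0..n}. M)"
proof -
  have "paths n = {x \<in> space (\<Pi>\<^sub>M k\<in>{0..n}. M). \<forall>k\<in>{1..n}. d (x (k - 1)) (x k) \<noteq> 0}"
    by (auto simp: paths_def space_PiM sp d0)
  also have "\<dots> \<in> sets (\<Pi>\<^sub>M k\<in>{0..n}. M)"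
  proof (intro sets.sets_Collect_finite_All)
    fix k assume "k \<in> {1..n}"
    show "{x \<in> space (\<Pi>\<^sub>M k\<in>{0..n}. M). d (x (k - 1)) (x k) \<noteq> 0} \<in> sets (\<Pi>\<^sub>M k\<in>{0..n}. M)"
      using path_step_measurable[OF meas \<open>k \<in> {1..n}\<close>] by (rule borel_measurable_neq[OF _ borel_measurable_const])
  qed simp
  finally show ?thesis .
qed

text \<open>\<open>weight\<close> says that the potential of \<open>M\<close> is the constant
  \<open>I\<close>. In the application \<open>M\<close> is \<open>c\<close> times the weight measure
  and \<open>I\<close> is \<open>c\<close>.\<close>

context
  fixes M :: "'a::{t2_space,second_countable_topology} measure" and d :: "'a \<Rightarrow> 'a \<Rightarrow> real" and I :: real
  assumes sets_M: "sets M = sets borel" and fin: "finite_measure M"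
    and atomless: "\<And>x. emeasure M {x} = 0"
    and d_meas: "case_prod d \<in> borel_measurable (M \<Otimes>\<^sub>M M)"
    and d0: "\<And>x y. d x y = 0 \<longleftrightarrow> x = y"
    and weight: "\<And>x. (\<integral>\<^sup>+y. ennreal (exp (- d x y)) \<partial>M) = ennreal I"
    and I0: "0 \<le> I"
begin

interpretation finite_measure M by (rule fin)

lemma nn_integral_paths:
  "(\<integral>\<^sup>+x. indicator (paths n) x * ennreal (exp (- path_len d n x)) \<partial>(\<Pi>\<^sub>M k\<in>{0..n}. M)) =
    ennreal (measure M UNIV * I ^ n)"
proof (induction n)
  case 0
  interpret P: product_sigma_finite "\<lambda>_::nat. M"
    by standard
  have sp: "space M = UNIV"
    using sets_eq_imp_space_eq[OF sets_M] by simp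
  have "paths 0 = space (\<Pi>\<^sub>M k\<in>{0::nat..0}. M)"
    by (auto simp: paths_def space_PiM sp)
  then have "(\<integral>\<^sup>+x. indicator (paths 0) x * ennreal (exp (- path_len d 0 x)) \<partial>(\<Pi>\<^sub>M k\<in>{0::nat..0}. M))
      = emeasure (\<Pi>\<^sub>M k\<in>{0::nat}. M) (space (\<Pi>\<^sub>M k\<in>{0::nat}. M))"
    by (simp add: path_len_def)
  also have "\<dots> = emeasure M UNIV"
    using P.emeasure_PiM[of "{0}" "\<lambda>_. UNIV"] by (simp add: space_PiM sp sets_M)
  finally show ?case
    by (simp add: emeasure_eq_measure)
next
  case (Suc n)
  interpret P: product_sigma_finite "\<lambda>_::nat. M"
    by standard
  have sp: "space M = UNIV"
    using sets_eq_imp_space_eq[OF sets_M] by simp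
  have ins: "{0..Suc n} = insert (Suc n) {0..n}"
    by auto
  let ?F = "\<lambda>n x. indicator (paths n) x * ennreal (exp (- path_len d n x))"
  have meas: "?F k \<in> borel_measurable (\<Pi>\<^sub>M k\<in>{0..k}. M)" for k
    using path_len_measurable[OF d_meas, of k] paths_measurable[OF d_meas d0 sp, of k] by measurable
  have "(\<integral>\<^sup>+x. ?F (Suc n) x \<partial>(\<Pi>\<^sub>M k\<in>{0..Suc n}. M)) =
      (\<integral>\<^sup>+x. (\<integral>\<^sup>+y. ?F (Suc n) (x(Suc n := y)) \<partial>M) \<partial>(\<Pi>\<^sub>M k\<in>{0..n}. M))"
    unfolding ins using meas[of "Suc n", unfolded ins] by (intro P.product_nn_integral_insert) auto
  also have "\<dots> = (\<integral>\<^sup>+x. ?F n x * ennreal I \<partial>(\<Pi>\<^sub>M k\<in>{0..n}. M))"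
  proof (intro nn_integral_cong)
    fix x assume "x \<in> space (\<Pi>\<^sub>M k\<in>{0..n}. M)"
    then have x: "x \<in> {0..n} \<rightarrow>\<^sub>E UNIV"
      by (simp add: space_PiM sp)
    have dx: "d (x n) \<in> borel_measurable M"
      using measurable_Pair2[OF d_meas, of "x n"] by (simp add: sp)
    have ae: "AE y in M. y \<noteq> x n"
      using atomless[of "x n"] by (intro AE_I'[of "{x n}"]) (auto simp: null_sets_def sets_M)
    \<comment> \<open>The new endpoint has to differ from \<open>x n\<close>, which excludes a null
      set, so the indicator of \<open>paths (Suc n)\<close> becomes that of
      \<open>paths n\<close>.\<close>
    have "(\<integral>\<^sup>+y. ?F (Suc n) (x(Suc n := y)) \<partial>M) = (\<integral>\<^sup>+y. ?F n x * ennreal (exp (- d (x n) y)) \<partial>M)"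
    proof (rule nn_integral_cong_AE, rule AE_mp[OF ae], intro AE_I2 impI)
      fix y assume "y \<noteq> x n"
      then show "?F (Suc n) (x(Suc n := y)) = ?F n x * ennreal (exp (- d (x n) y))"
        using paths_Suc_upd[OF x, of y]
        by (simp add: path_len_Suc_upd indicator_def ennreal_mult[symmetric] exp_add[symmetric])
    qed
    also have "\<dots> = ?F n x * ennreal I"
      using dx by (subst nn_integral_cmult) (auto simp: weight)
    finally show "(\<integral>\<^sup>+y. ?F (Suc n) (x(Suc n := y)) \<partial>M) = ?F n x * ennreal I" .
  qed
  also have "\<dots> = (\<integral>\<^sup>+x. ?F n x \<partial>(\<Pi>\<^sub>M k\<in>{0..n}. M)) * ennreal I"
    by (rule nn_integral_multc[OF meas])
  also have "\<dots> = ennreal (measure M UNIV * I ^ Suc n)"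
    unfolding Suc.IH using I0 by (simp add: ennreal_mult[symmetric] mult_ac)
  finally show ?case .
qed

lemma magnitude_upto_weight:
  assumes geo: "\<And>x y. x \<noteq> y \<Longrightarrow> geodesics d x y \<noteq> {}"
  shows "magnitude_upto d M (triv_measure d) N = measure M UNIV * (\<Sum>n\<le>N. (- I) ^ n)"
proof -
  have sp: "space M = UNIV"
    using sets_eq_imp_space_eq[OF sets_M] by simp
  have inner: "(LINT \<gamma>|(\<Pi>\<^sub>M k\<in>{1..n}. triv_measure d (x (k - 1)) (x k)). exp (- path_len d n x)) =
      exp (- path_len d n x)" if "x \<in> paths n" for n x
  proof -
    interpret prob_space "\<Pi>\<^sub>M k\<in>{1..n}. triv_measure d (x (k - 1)) (x k)"
      using that by (intro prob_space_PiM prob_space_triv_measure geo) (auto simp: paths_def)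
    show ?thesis
      using prob_space by simp
  qed
  have summand: "(LINT x:paths n|(\<Pi>\<^sub>M k\<in>{0..n}. M).
      (LINT \<gamma>|(\<Pi>\<^sub>M k\<in>{1..n}. triv_measure d (x (k - 1)) (x k)). exp (- path_len d n x))) =
      measure M UNIV * I ^ n" for n
  proof -
    let ?g = "\<lambda>x. indicator (paths n) x * exp (- path_len d n x)"
    have "(LINT x:paths n|(\<Pi>\<^sub>M k\<in>{0..n}. M).
      (LINT \<gamma>|(\<Pi>\<^sub>M k\<in>{1..n}. triv_measure d (x (k - 1)) (x k)). exp (- path_len d n x))) =
      (LINT x|(\<Pi>\<^sub>M k\<in>{0..n}. M). ?g x)"
      unfolding set_lebesgue_integral_def
      
    proof (intro Bochner_Integration.integral_cong refl)
      fix x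
      \<comment> \<open>Off \<open>paths n\<close> the integral over geodesics need not have this
        value, since coinciding points are joined by none; the indicator vanishes there.\<close>
      show "indicator (paths n) x *\<^sub>R (LINT \<gamma>|(\<Pi>\<^sub>M k\<in>{1..n}. triv_measure d (x (k - 1)) (x k)).
          exp (- path_len d n x)) = ?g x"
        by (cases "x \<in> paths n")
          (simp_all only: inner indicator_simps scaleR_one mult_1 scaleR_zero_left mult_zero_left
            simp_thms)
    qed
    also have "\<dots> = enn2real (\<integral>\<^sup>+x. ennreal (?g x) \<partial>(\<Pi>\<^sub>M k\<in>{0..n}. M))"
      using path_len_measurable[OF d_meas, of n] paths_measurable[OF d_meas d0 sp, of n]
      by (intro integral_eq_nn_integral) auto
    also have "(\<integral>\<^sup>+x. ennreal (?g x) \<partial>(\<Pi>\<^sub>M k\<in>{0..n}. M)) = 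
      (\<integral>\<^sup>+x. indicator (paths n) x * ennreal (exp (- path_len d n x)) \<partial>(\<Pi>\<^sub>M k\<in>{0..n}. M))"
      by (intro nn_integral_cong) (auto simp: indicator_def)
    finally show ?thesis
      unfolding nn_integral_paths using I0 by simp
  qed
  \<comment> \<open>\<open>measure M UNIV\<close>, which stands in front of the sum in
    \<open>magnitude_upto\<close>, is the term \<open>n = 0\<close> of the geometric sum.\<close>
  have "{..N} = insert 0 {1..N}"
    by auto
  then show ?thesis
    unfolding magnitude_upto_def summand
    by (simp add: sp sum_distrib_left distrib_left power_minus[of I] mult_ac)
qed

end

section \<open>Minimising geodesics in compact length spaces\<close>

lemma geodesics_nonempty:
  fixes d :: "'a::{t2_space,first_countable_topology} \<Rightarrow> 'a \<Rightarrow> real"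
  assumes comp: "compact (UNIV :: 'a set)"
    and cont: "\<And>q. continuous_on UNIV (\<lambda>p. d p q)"
    and d0: "\<And>x y. d x y = 0 \<longleftrightarrow> x = y"
    and sym: "\<And>x y. d x y = d y x"
    and tri: "\<And>x y z. d x z \<le> d x y + d y z"
    and between: "\<And>x y a. 0 \<le> a \<Longrightarrow> a \<le> d x y \<Longrightarrow> \<exists>m. d x m = a \<and> d m y = d x y - a"
    and "x \<noteq> y"
  shows "geodesics d x y \<noteq> {}"
proof -
  define D where "D = d x y"
  have nonneg: "0 \<le> d p q" for p q
    using tri[of p p q] d0[of p p] sym[of p q] by simp
  have D: "D > 0"
    using nonneg[of x y] d0[of x y] \<open>x \<noteq> y\<close> by (simp add: D_def)
  \<comment> \<open>Partial parametrisations are kept as relations, which makes unions of chains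
    easy. The distance condition at equal times gives 0, hence at most one point per time.\<close>
  define G where "G = {R. R \<subseteq> {0..1} \<times> UNIV \<and> (0, x) \<in> R \<and> (1, y) \<in> R \<and>
    (\<forall>s p t q. (s, p) \<in> R \<longrightarrow> (t, q) \<in> R \<longrightarrow> d p q = \<bar>s - t\<bar> * D)}"
  have "{(0, x), (1, y)} \<in> G"
    using d0 sym[of x y] by (auto simp: G_def D_def)
  moreover have "\<Union>C \<in> G" if "C \<noteq> {}" and chain: "subset.chain G C" for C
  proof -
    have CG: "C \<subseteq> G" and CC: "\<And>R R'. R \<in> C \<Longrightarrow> R' \<in> C \<Longrightarrow> R \<subseteq> R' \<or> R' \<subseteq> R"
      using chain by (auto simp: subset_chain_def)
    have "d p q = \<bar>s - t\<bar> * D"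
      if R: "R \<in> C" "(s, p) \<in> R" "R' \<in> C" "(t, q) \<in> R'" for R R' s t p q
    proof -
      obtain S where "S \<in> C" "(s, p) \<in> S" "(t, q) \<in> S"
        using R CC[of R R'] by blast
      then show ?thesis
        using CG unfolding G_def by blast
    qed
    moreover have "\<Union>C \<subseteq> {0..1} \<times> UNIV" "(0, x) \<in> \<Union>C" "(1, y) \<in> \<Union>C"
      using CG \<open>C \<noteq> {}\<close> unfolding G_def by auto
    ultimately show ?thesis
      unfolding G_def by (simp only: mem_Collect_eq) (metis UnionE)
  qed
  ultimately obtain R where RG: "R \<in> G" and maxi: "\<And>X. X \<in> G \<Longrightarrow> R \<subseteq> X \<Longrightarrow> X = R"
    using subset_Zorn_nonempty[of G] by blast
  have R01: "(t, p) \<in> R \<Longrightarrow> 0 \<le> t \<and> t \<le> 1" for t p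
    using RG unfolding G_def by auto
  have R0: "(0, x) \<in> R" and R1: "(1, y) \<in> R"
    and Rd: "(s, p) \<in> R \<Longrightarrow> (t, q) \<in> R \<Longrightarrow> d p q = \<bar>s - t\<bar> * D" for s p t q
    using RG unfolding G_def by auto
  \<comment> \<open>Maximality in usable form: a point at the right distance from every member of
    \<open>R\<close> already belongs to \<open>R\<close>.\<close>
  have extend: "(s, m) \<in> R"
    if "s \<in> {0..1}" and m: "\<And>r z. (r, z) \<in> R \<Longrightarrow> d z m = \<bar>r - s\<bar> * D" for s m
  proof -
    have "d m z = \<bar>s - r\<bar> * D" if "(r, z) \<in> R" for r z
      using m[OF that] sym[of m z] by (simp add: abs_minus_commute)
    then have "d p q = \<bar>s' - t\<bar> * D" if "(s', p) \<in> insert (s, m) R" "(t, q) \<in> insert (s, m) R"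
      for s' p t q
      using that m Rd d0[of m m] by (elim insertE) auto
    then have "insert (s, m) R \<in> G"
      using RG \<open>s \<in> {0..1}\<close> unfolding G_def by (simp only: mem_Collect_eq insert_subset) auto
    then show ?thesis
      using maxi[of "insert (s, m) R"] by auto
  qed
  define T where "T = fst ` R"
  \<comment> \<open>For convergent times in \<open>T\<close>, a limit of a subsequence of their
    points has the right distance from all of \<open>R\<close> by continuity, so
    \<open>extend\<close> applies to it.\<close>
  have "closed T"
    unfolding closed_sequential_limits
  proof (intro allI impI, elim conjE)
    fix u l assume u: "\<forall>n. u n \<in> T" and lim: "u \<longlonglongrightarrow> l"
    have "\<exists>p. (u n, p) \<in> R" for n
      using spec[OF u, of n] unfolding T_def by auto
    then obtain P where P: "\<And>n. (u n, P n) \<in> R"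
      by metis
    obtain p r where r: "strict_mono (r :: nat \<Rightarrow> nat)" and p: "(P \<circ> r) \<longlonglongrightarrow> p"
      using compact_imp_seq_compact[OF comp, unfolded seq_compact_def, rule_format, of P] by auto
    have ur: "(u \<circ> r) \<longlonglongrightarrow> l"
      using lim r by (rule LIMSEQ_subseq_LIMSEQ)
    have "l \<in> {0..1}"
      using P R01 by (intro closed_sequentially[OF _ _ lim]) auto
    moreover have "d z p = \<bar>t - l\<bar> * D" if "(t, z) \<in> R" for t z
    proof (rule LIMSEQ_unique)
      show "(\<lambda>n. d ((P \<circ> r) n) z) \<longlonglongrightarrow> d z p"
        using continuous_on_tendsto_compose[OF cont[of z] p] sym[of z p] by simp
      have "(\<lambda>n. d ((P \<circ> r) n) z) = (\<lambda>n. \<bar>t - (u \<circ> r) n\<bar> * D)"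
        using Rd[OF P that] by (auto simp: abs_minus_commute)
      then show "(\<lambda>n. d ((P \<circ> r) n) z) \<longlonglongrightarrow> \<bar>t - l\<bar> * D"
        using ur by (auto intro!: tendsto_intros simp: comp_def)
    qed
    ultimately show "l \<in> T"
      using extend[of l p] unfolding T_def by force
  qed
  have "T = {0..1}"
  proof (rule antisym)
    show "T \<subseteq> {0..1}"
      using R01 unfolding T_def by auto
    show "{0..1} \<subseteq> T"
    proof (rule ccontr)
      assume "\<not> {0..1} \<subseteq> T"
      then obtain s where "s \<in> {0..1}" and "s \<notin> T"
        by blast
      then have s: "0 \<le> s" "s \<le> 1" "s \<notin> T"
        by simp_all
      have T01: "0 \<in> T" "1 \<in> T"
        using R0 R1 unfolding T_def by force+
      \<comment> \<open>\<open>a\<close> and \<open>b\<close> are the ends of the gap of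
        \<open>T\<close> around the missing time \<open>s\<close>; they lie in \<open>T\<close>
        because it is closed.\<close>
      define a where "a = Sup (T \<inter> {..s})"
      define b where "b = Inf (T \<inter> {s..})"
      have a: "a \<in> T \<inter> {..s}"
        unfolding a_def using T01 s \<open>closed T\<close> by (intro closed_contains_Sup) auto
      have b: "b \<in> T \<inter> {s..}"
        unfolding b_def using T01 s \<open>closed T\<close> by (intro closed_contains_Inf) auto
      have gap: "r \<le> a \<or> b \<le> r" if "r \<in> T" for r
        using that unfolding a_def b_def
        by (cases "r \<le> s") (auto intro!: cSup_upper cInf_lower)
      obtain p q where p: "(a, p) \<in> R" and q: "(b, q) \<in> R"
        using a b unfolding T_def by auto
      have as: "a < s" "s < b"
        using a b s by (auto simp: less_le)
      have "d p q = (b - a) * D"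
        using Rd[OF p q] as by simp
      moreover have "(s - a) * D \<le> (b - a) * D"
        using as D by (intro mult_right_mono) auto
      \<comment> \<open>\<open>between\<close> puts \<open>m\<close> on the way from
        \<open>p\<close> to \<open>q\<close>, at the distance from \<open>p\<close> that the time
        \<open>s\<close> requires.\<close>
      ultimately obtain m where pm: "d p m = (s - a) * D" and mq: "d m q = (b - a) * D - (s - a) * D"
        using between[of "(s - a) * D" p q] as D by auto
      \<comment> \<open>Passing through the end of the gap nearer to \<open>z\<close> bounds
        \<open>d z m\<close> from above; the distance from \<open>z\<close> to the farther end
        bounds it from below.\<close>
      have "d z m = \<bar>r - s\<bar> * D" if "(r, z) \<in> R" for r z
      proof -
        have "r \<in> T"
          using that unfolding T_def by force
        have "d z p = \<bar>r - a\<bar> * D" "d z q = \<bar>r - b\<bar> * D"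
          using Rd that p q by auto
        then show ?thesis
          using gap[OF \<open>r \<in> T\<close>] as tri[of z m p] tri[of z q m] tri[of z m q] tri[of z p m] pm mq
            sym[of m p] sym[of m q]
          by (auto simp: algebra_simps)
      qed
      then have "(s, m) \<in> R"
        using s by (intro extend) auto
      then show False
        using s unfolding T_def by force
    qed
  qed
  then have ex: "\<exists>p. (t, p) \<in> R" if "t \<in> {0..1}" for t
    using that unfolding T_def by force
  define \<gamma> where "\<gamma> = (\<lambda>t\<in>{0..1}. SOME p. (t, p) \<in> R)"
  have \<gamma>R: "(t, \<gamma> t) \<in> R" if "t \<in> {0..1}" for t
    using someI_ex[OF ex[OF that]] that by (simp add: \<gamma>_def)
  have "\<gamma> 0 = x" "\<gamma> 1 = y"
    using Rd[OF \<gamma>R[of 0] R0] Rd[OF \<gamma>R[of 1] R1] by (auto simp: d0)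
  moreover have "d (\<gamma> s) (\<gamma> t) = \<bar>s - t\<bar> * d x y" if "s \<in> {0..1}" "t \<in> {0..1}" for s t
    using Rd[OF \<gamma>R \<gamma>R] that by (simp add: D_def)
  moreover have "\<gamma> \<in> extensional {0..1}"
    by (simp add: \<gamma>_def)
  ultimately have "\<gamma> \<in> geodesics d x y"
    using \<open>x \<noteq> y\<close> unfolding geodesics_def by (auto intro!: bexI[of _ 1])
  then show ?thesis
    by auto
qed

section \<open>Length and distance on a Riemannian manifold\<close>

lemma continuous_on_local:
  assumes "\<And>x. x \<in> S \<Longrightarrow> \<exists>U. open U \<and> x \<in> U \<and> continuous_on (S \<inter> U) f"
  shows "continuous_on S f"
  unfolding continuous_on_def
proof
  fix x assume "x \<in> S"
  then obtain U where U: "open U" "x \<in> U" "continuous_on (S \<inter> U) f"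
    using assms by blast
  then have "(f \<longlongrightarrow> f x) (at x within S \<inter> U)"
    using \<open>x \<in> S\<close> by (auto simp: continuous_on_def)
  moreover have "at x within S \<inter> U = at x within S"
    using U by (intro at_within_nhd[of x U]) auto
  ultimately show "(f \<longlongrightarrow> f x) (at x within S)"
    by simp
qed

lemma continuous_on_matrix_vector_mult:
  fixes M :: "'a::topological_space \<Rightarrow> real ^ 'n ^ 'm"
  assumes "continuous_on S M" "continuous_on S v"
  shows "continuous_on S (\<lambda>x. M x *v v x)"
  unfolding matrix_vector_mult_def using assms
  by (intro continuous_on_vec_lambda continuous_intros)

lemma smooth_on_differentiable: "smooth_on S f \<Longrightarrow> x \<in> S \<Longrightarrow> f differentiable (at x)"
  unfolding smooth_on_def by (auto dest: spec[of _ "Suc 0"])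

lemma smooth_on_continuous_frechet:
  "smooth_on S f \<Longrightarrow> continuous_on S (\<lambda>x. frechet_derivative f (at x) v)"
  unfolding smooth_on_def by (auto dest: spec[of _ "Suc 0"])

lemma smooth_on_continuous: "smooth_on S f \<Longrightarrow> continuous_on S f"
  unfolding smooth_on_def by (auto dest: spec[of _ 0])

lemma jacobian_has_derivative:
  assumes "f differentiable (at x)"
  shows "(f has_derivative (*v) (jacobian f x)) (at x)"
proof -
  have "(f has_derivative frechet_derivative f (at x)) (at x)"
    using assms by (simp add: frechet_derivative_works)
  moreover from this have "linear (frechet_derivative f (at x))"
    by (rule has_derivative_linear)
  ultimately show ?thesis
    by (simp add: jacobian_def)
qed

lemma smooth_on_continuous_jacobian:
  assumes "smooth_on S f"
  shows "continuous_on S (jacobian f)"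
  unfolding jacobian_def matrix_def
  by (intro continuous_on_vec_lambda continuous_on_component smooth_on_continuous_frechet[OF assms])

text \<open>With a Jacobian as \<open>J\<close>, this turns the transformation rule of the metric
  into preservation of norms.\<close>

lemma inner_matrix_congruence:
  fixes J G :: "real ^ 'n ^ 'n"
  shows "(J *v w) \<bullet> (G *v (J *v w)) = w \<bullet> ((transpose J ** G ** J) *v w)"
proof -
  have "(J *v w) \<bullet> (G *v (J *v w)) = (w v* transpose J) \<bullet> (G *v (J *v w))"
    by (simp add: vector_transpose_matrix)
  then show ?thesis
    by (simp only: dot_lmul_matrix matrix_vector_mul_assoc matrix_mul_assoc)
qed

section \<open>Charts, tangent norms and isometries in coordinates\<close>

locale riemannian =
  fixes A :: "('a::{t2_space,second_countable_topology}, 'n::finite) chart set"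
    and g :: "('a, 'n) metric_tensor"
  assumes atlas: "smooth_atlas A" and metric: "riemannian_metric A g"
begin

lemma chart_at: "\<exists>c\<in>A. p \<in> fst c"
  using atlas unfolding smooth_atlas_def by blast

lemma open_chart: "c \<in> A \<Longrightarrow> open (fst c)"
  and open_chart_image: "c \<in> A \<Longrightarrow> open (snd c ` fst c)"
  and inj_chart: "c \<in> A \<Longrightarrow> inj_on (snd c) (fst c)"
  and continuous_chart: "c \<in> A \<Longrightarrow> continuous_on (fst c) (snd c)"
  and continuous_chart_inv: "c \<in> A \<Longrightarrow> continuous_on (snd c ` fst c) (chart_inv c)"
  using atlas unfolding smooth_atlas_def is_chart_def homeomorphism_def by auto

lemma chart_inv_chart [simp]: "c \<in> A \<Longrightarrow> p \<in> fst c \<Longrightarrow> chart_inv c (snd c p) = p"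
  by (simp add: inj_chart)

lemma chart_chart_inv [simp]: "x \<in> snd c ` fst c \<Longrightarrow> snd c (chart_inv c x) = x"
  by (rule f_inv_into_f)

lemma chart_inv_in [simp]: "x \<in> snd c ` fst c \<Longrightarrow> chart_inv c x \<in> fst c"
  by (rule inv_into_into)

text \<open>The Riemannian norm of the tangent vector at \<open>p\<close> whose coordinates in the
  chart \<open>c\<close> are \<open>w\<close>.\<close>

definition tangent_norm :: "('a, 'n) chart \<Rightarrow> 'a \<Rightarrow> real ^ 'n \<Rightarrow> real" where
  "tangent_norm c p w = sqrt (w \<bullet> (g c p *v w))"

lemma metric_pos: "c \<in> A \<Longrightarrow> p \<in> fst c \<Longrightarrow> w \<noteq> 0 \<Longrightarrow> 0 < w \<bullet> (g c p *v w)"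
  using metric unfolding riemannian_metric_def by blast

lemma tangent_norm_nonneg: "c \<in> A \<Longrightarrow> p \<in> fst c \<Longrightarrow> 0 \<le> tangent_norm c p w"
  using metric_pos[of c p w] by (cases "w = 0") (auto simp: tangent_norm_def)

lemma tangent_norm_pos: "c \<in> A \<Longrightarrow> p \<in> fst c \<Longrightarrow> w \<noteq> 0 \<Longrightarrow> 0 < tangent_norm c p w"
  using metric_pos[of c p w] by (auto simp: tangent_norm_def)

lemma tangent_norm_scaleR: "tangent_norm c p (r *\<^sub>R w) = \<bar>r\<bar> * tangent_norm c p w"
  by (simp add: tangent_norm_def matrix_vector_mult_scaleR real_sqrt_mult mult.assoc[symmetric])

lemma continuous_on_metric:
  assumes "c \<in> A"
  shows "continuous_on (fst c) (g c)"
proof -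
  have "continuous_on (fst c) (\<lambda>p. g c p $ i $ j)" for i j
  proof -
    have "continuous_on (snd c ` fst c) (\<lambda>x. g c (chart_inv c x) $ i $ j)"
      using metric assms smooth_on_continuous unfolding riemannian_metric_def by blast
    from continuous_on_compose2[OF this continuous_chart[OF assms]] show ?thesis
      using assms by (simp cong: continuous_on_cong)
  qed
  then have "continuous_on (fst c) (\<lambda>p. \<chi> i j. g c p $ i $ j)"
    by (intro continuous_on_vec_lambda)
  then show ?thesis
    by simp
qed

lemma continuous_on_tangent_norm:
  assumes "c \<in> A" "continuous_on S p" "p ` S \<subseteq> fst c" "continuous_on S w"
  shows "continuous_on S (\<lambda>t. tangent_norm c (p t) (w t))"
  unfolding tangent_norm_def
  by (intro continuous_intros continuous_on_matrix_vector_mult assms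
      continuous_on_compose2[OF continuous_on_metric[OF \<open>c \<in> A\<close>]])

text \<open>Compatibility of the charts and the transformation rule of the metric are exactly the
  isometry conditions for \<open>id\<close>. Chart independence thereby becomes an instance of
  isometry invariance.\<close>

lemma riemannian_isometry_id: "riemannian_isometry A g id"
proof -
  have "smooth_map A id"
    using atlas unfolding smooth_map_def smooth_atlas_def vimage_id id_apply
    by (simp add: continuous_on_id)
  moreover have "\<forall>c\<in>A. \<forall>c'\<in>A. \<forall>p\<in>fst c \<inter> id -` fst c'.
      let J = jacobian (local_rep c c' id) (snd c p) in g c p = transpose J ** g c' (id p) ** J"
    using metric unfolding riemannian_metric_def vimage_id id_apply by blast
  ultimately show ?thesis
    unfolding riemannian_isometry_def by (simp only: inv_id bij_id simp_thms)
qed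

lemma isometry_smooth:
  "riemannian_isometry A g f \<Longrightarrow> c \<in> A \<Longrightarrow> c' \<in> A \<Longrightarrow>
    smooth_on (snd c ` (fst c \<inter> f -` fst c')) (local_rep c c' f)"
  unfolding riemannian_isometry_def smooth_map_def by blast

lemma isometry_pullback:
  "riemannian_isometry A g f \<Longrightarrow> c \<in> A \<Longrightarrow> c' \<in> A \<Longrightarrow> p \<in> fst c \<Longrightarrow> f p \<in> fst c' \<Longrightarrow>
    g c p = transpose (jacobian (local_rep c c' f) (snd c p)) ** g c' (f p) **
      jacobian (local_rep c c' f) (snd c p)"
  unfolding riemannian_isometry_def Let_def by blast

lemma isometry_continuous: "riemannian_isometry A g f \<Longrightarrow> continuous_on S f"
  unfolding riemannian_isometry_def smooth_map_def using continuous_on_subset by blast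

text \<open>Chain rule through the local representative of \<open>f\<close>, whose Jacobian
  preserves norms by the pullback rule. Derivatives within \<open>S\<close> cover the one-sided ones
  at the ends of an interval.\<close>

lemma isometry_has_vector_derivative:
  assumes f: "riemannian_isometry A g f" and c: "c \<in> A" "c' \<in> A"
    and t: "t \<in> S" "\<gamma> t \<in> fst c" "f (\<gamma> t) \<in> fst c'"
    and cont: "continuous_on S \<gamma>"
    and der: "((snd c \<circ> \<gamma>) has_vector_derivative w) (at t within S)"
  defines "J \<equiv> jacobian (local_rep c c' f) (snd c (\<gamma> t))"
  shows "((snd c' \<circ> (f \<circ> \<gamma>)) has_vector_derivative J *v w) (at t within S)"
    and "tangent_norm c' (f (\<gamma> t)) (J *v w) = tangent_norm c (\<gamma> t) w"
proof -
  let ?L = "local_rep c c' f"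
  have "snd c (\<gamma> t) \<in> snd c ` (fst c \<inter> f -` fst c')"
    using t by auto
  then have "(?L has_derivative (*v) J) (at (snd c (\<gamma> t)))"
    unfolding J_def
    by (intro jacobian_has_derivative smooth_on_differentiable[OF isometry_smooth[OF f c]])
  then have "(?L has_derivative (*v) J) (at ((snd c \<circ> \<gamma>) t) within (snd c \<circ> \<gamma>) ` S)"
    by (simp add: has_derivative_at_withinI)
  from vector_derivative_diff_chain_within[OF der this]
  have "((?L \<circ> (snd c \<circ> \<gamma>)) has_vector_derivative J *v w) (at t within S)" .
  \<comment> \<open>Near \<open>t\<close> the curve stays in the domain of \<open>c\<close>, where
    \<open>chart_inv c\<close> undoes the chart.\<close>
  moreover have "\<forall>\<^sub>F s in at t within S. (?L \<circ> (snd c \<circ> \<gamma>)) s = (snd c' \<circ> (f \<circ> \<gamma>)) s"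
  proof -
    have "\<forall>\<^sub>F s in at t within S. \<gamma> s \<in> fst c"
      using cont t open_chart[OF c(1)] unfolding continuous_on_def by (blast intro: topological_tendstoD)
    then show ?thesis
      by eventually_elim (use c in \<open>simp add: local_rep_def\<close>)
  qed
  ultimately show "((snd c' \<circ> (f \<circ> \<gamma>)) has_vector_derivative J *v w) (at t within S)"
    unfolding has_vector_derivative_def
    by (rule has_derivative_transform_eventually) (use c t in \<open>simp_all add: local_rep_def\<close>)
  show "tangent_norm c' (f (\<gamma> t)) (J *v w) = tangent_norm c (\<gamma> t) w"
    unfolding tangent_norm_def inner_matrix_congruence J_def
    using isometry_pullback[OF f c t(2,3)] by simp
qed

end

text \<open>Replaces the relatively open set of times spent in a chart by an ambient open set, the
  form in which \<open>continuous_on_local\<close> takes neighbourhoods.\<close>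

lemma continuous_on_open_vimageE:
  assumes "continuous_on S f" "open V"
  obtains U where "open U" "\<And>x. x \<in> S \<Longrightarrow> x \<in> U \<longleftrightarrow> f x \<in> V"
proof -
  obtain U where "open U" "U \<inter> S = f -` V \<inter> S"
    using assms unfolding continuous_on_open_invariant by blast
  then show ?thesis
    using that[of U] by blast
qed

section \<open>Continuously differentiable arcs and their speed\<close>

context riemannian
begin

text \<open>Compared with \<open>C1_curve_on\<close> it records a speed \<open>\<sigma>\<close> that
  is the same in every chart. Being taken within \<open>{a..b}\<close>, the speed is meaningful at
  the ends too, where the two-sided derivative in \<open>curve_speed\<close> may fail to
  exist.\<close>

definition C1_arc :: "(real \<Rightarrow> 'a) \<Rightarrow> real \<Rightarrow> real \<Rightarrow> (real \<Rightarrow> real) \<Rightarrow> bool" where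
  "C1_arc \<gamma> a b \<sigma> \<longleftrightarrow> a < b \<and> continuous_on {a..b} \<gamma> \<and>
     (\<forall>c\<in>A. \<exists>v. continuous_on ({a..b} \<inter> \<gamma> -` fst c) v \<and>
        (\<forall>t\<in>{a..b} \<inter> \<gamma> -` fst c.
           ((snd c \<circ> \<gamma>) has_vector_derivative v t) (at t within {a..b}) \<and>
           \<sigma> t = tangent_norm c (\<gamma> t) (v t)))"

lemma C1_arcD:
  assumes "C1_arc \<gamma> a b \<sigma>"
  shows "a < b" "continuous_on {a..b} \<gamma>"
  using assms by (auto simp: C1_arc_def)

lemma C1_arcE:
  assumes "C1_arc \<gamma> a b \<sigma>" "c \<in> A"
  obtains v where "continuous_on ({a..b} \<inter> \<gamma> -` fst c) v"
    "\<And>t. t \<in> {a..b} \<Longrightarrow> \<gamma> t \<in> fst c \<Longrightarrow>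
      ((snd c \<circ> \<gamma>) has_vector_derivative v t) (at t within {a..b})"
    "\<And>t. t \<in> {a..b} \<Longrightarrow> \<gamma> t \<in> fst c \<Longrightarrow> \<sigma> t = tangent_norm c (\<gamma> t) (v t)"
proof -
  obtain v where "continuous_on ({a..b} \<inter> \<gamma> -` fst c) v"
    "\<forall>t\<in>{a..b} \<inter> \<gamma> -` fst c. ((snd c \<circ> \<gamma>) has_vector_derivative v t) (at t within {a..b}) \<and>
        \<sigma> t = tangent_norm c (\<gamma> t) (v t)"
    using assms unfolding C1_arc_def by blast
  then show ?thesis
    by (intro that[of v]) simp_all
qed

text \<open>With \<open>f = id\<close> this is independence of the choice of charts.\<close>

lemma C1_arc_isometry_local:
  assumes f: "riemannian_isometry A g f" and "a < b" and cont: "continuous_on {a..b} \<gamma>"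
    and loc: "\<And>t. t \<in> {a..b} \<Longrightarrow> \<exists>c\<in>A. \<exists>v. \<gamma> t \<in> fst c \<and> continuous_on ({a..b} \<inter> \<gamma> -` fst c) v \<and>
      (\<forall>s\<in>{a..b} \<inter> \<gamma> -` fst c.
         ((snd c \<circ> \<gamma>) has_vector_derivative v s) (at s within {a..b}) \<and>
         \<sigma> s = tangent_norm c (\<gamma> s) (v s))"
  shows "C1_arc (f \<circ> \<gamma>) a b \<sigma>"
  unfolding C1_arc_def
proof (intro conjI ballI)
  show "a < b" by fact
  show "continuous_on {a..b} (f \<circ> \<gamma>)"
    by (intro continuous_on_compose cont isometry_continuous[OF f])
  fix c' assume c': "c' \<in> A"
  let ?S = "{a..b} \<inter> (f \<circ> \<gamma>) -` fst c'"
  \<comment> \<open>The candidate velocity makes no reference to the auxiliary chart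
    \<open>c\<close>, so its descriptions \<open>J s *v v s\<close> on the various sets
    \<open>U\<close> fit together without further checking.\<close>
  define v' where "v' t = vector_derivative (snd c' \<circ> (f \<circ> \<gamma>)) (at t within {a..b})" for t
  have key: "\<exists>U. open U \<and> t \<in> U \<and> continuous_on (?S \<inter> U) v' \<and>
      ((snd c' \<circ> (f \<circ> \<gamma>)) has_vector_derivative v' t) (at t within {a..b}) \<and>
      \<sigma> t = tangent_norm c' ((f \<circ> \<gamma>) t) (v' t)" if t: "t \<in> ?S" for t
  proof -
    obtain c v where c: "c \<in> A" "\<gamma> t \<in> fst c" and v: "continuous_on ({a..b} \<inter> \<gamma> -` fst c) v"
      and d: "\<And>s. s \<in> {a..b} \<inter> \<gamma> -` fst c \<Longrightarrow>
          ((snd c \<circ> \<gamma>) has_vector_derivative v s) (at s within {a..b}) \<and>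
          \<sigma> s = tangent_norm c (\<gamma> s) (v s)"
      using loc[of t] t by (auto simp del: vimage_eq)
    obtain U where U: "open U" "\<And>s. s \<in> {a..b} \<Longrightarrow> s \<in> U \<longleftrightarrow> \<gamma> s \<in> fst c"
      using continuous_on_open_vimageE[OF cont open_chart[OF c(1)]] by blast
    define J where "J s = jacobian (local_rep c c' f) (snd c (\<gamma> s))" for s
    have der: "((snd c' \<circ> (f \<circ> \<gamma>)) has_vector_derivative J s *v v s) (at s within {a..b})"
      and nrm: "tangent_norm c' (f (\<gamma> s)) (J s *v v s) = \<sigma> s" if s: "s \<in> ?S \<inter> U" for s
    proof -
      have s': "s \<in> {a..b}" "\<gamma> s \<in> fst c" "f (\<gamma> s) \<in> fst c'"
        using s U by auto
      then have "((snd c \<circ> \<gamma>) has_vector_derivative v s) (at s within {a..b})"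
        "\<sigma> s = tangent_norm c (\<gamma> s) (v s)"
        using d[of s] by auto
      then show "((snd c' \<circ> (f \<circ> \<gamma>)) has_vector_derivative J s *v v s) (at s within {a..b})"
        "tangent_norm c' (f (\<gamma> s)) (J s *v v s) = \<sigma> s"
        using isometry_has_vector_derivative[OF f c(1) c' s' cont] by (auto simp: J_def)
    qed
    have v'_eq: "v' s = J s *v v s" if "s \<in> ?S \<inter> U" for s
      unfolding v'_def using der[OF that] that \<open>a < b\<close>
      by (intro vector_derivative_within_closed_interval) auto
    have "continuous_on (?S \<inter> U) J"
      unfolding J_def
    proof (rule continuous_on_compose2[OF smooth_on_continuous_jacobian[OF isometry_smooth[OF f c(1) c']]])
      have *: "?S \<inter> U \<subseteq> {a..b}" "\<gamma> ` (?S \<inter> U) \<subseteq> fst c \<inter> f -` fst c'"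
        using U by auto
      show "continuous_on (?S \<inter> U) (\<lambda>s. snd c (\<gamma> s))"
        using * continuous_on_subset[OF cont *(1)]
        by (intro continuous_on_compose2[OF continuous_chart[OF c(1)]]) auto
      show "(\<lambda>s. snd c (\<gamma> s)) ` (?S \<inter> U) \<subseteq> snd c ` (fst c \<inter> f -` fst c')"
        using *(2) by blast
    qed
    moreover have "continuous_on (?S \<inter> U) v"
      using U by (intro continuous_on_subset[OF v]) auto
    ultimately have "continuous_on (?S \<inter> U) v'"
      using v'_eq by (subst continuous_on_cong[OF refl v'_eq]) (auto intro: continuous_on_matrix_vector_mult)
    moreover have "t \<in> ?S \<inter> U"
      using t U c(2) by auto
    ultimately show ?thesis
      using U(1) der[of t] nrm[of t] v'_eq[of t] by auto
  qed
  show "\<exists>v. continuous_on ?S v \<and> (\<forall>t\<in>?S. ((snd c' \<circ> (f \<circ> \<gamma>)) has_vector_derivative v t) (at t within {a..b}) \<and>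
      \<sigma> t = tangent_norm c' ((f \<circ> \<gamma>) t) (v t))"
  proof (intro exI[of _ v'] conjI ballI)
    show "continuous_on ?S v'"
      using key by (intro continuous_on_local) meson
  qed (use key in meson)+
qed

lemma C1_arc_isometry:
  assumes "riemannian_isometry A g f" "C1_arc \<gamma> a b \<sigma>"
  shows "C1_arc (f \<circ> \<gamma>) a b \<sigma>"
proof (rule C1_arc_isometry_local)
  fix t assume t: "t \<in> {a..b}"
  obtain c where "c \<in> A" "\<gamma> t \<in> fst c"
    using chart_at by blast
  then show "\<exists>c\<in>A. \<exists>v. \<gamma> t \<in> fst c \<and> continuous_on ({a..b} \<inter> \<gamma> -` fst c) v \<and>
      (\<forall>s\<in>{a..b} \<inter> \<gamma> -` fst c. ((snd c \<circ> \<gamma>) has_vector_derivative v s) (at s within {a..b}) \<and>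
         \<sigma> s = tangent_norm c (\<gamma> s) (v s))"
    using assms(2) unfolding C1_arc_def by blast
qed (use assms in \<open>auto simp: C1_arc_def\<close>)

text \<open>For a curve that stays in one chart, such as a coordinate segment, only this chart has
  to be inspected.\<close>

lemma C1_arc_in_chart:
  assumes "a < b" "c \<in> A" "continuous_on {a..b} \<gamma>" "\<gamma> ` {a..b} \<subseteq> fst c" "continuous_on {a..b} v"
    and "\<And>t. t \<in> {a..b} \<Longrightarrow> ((snd c \<circ> \<gamma>) has_vector_derivative v t) (at t within {a..b})"
  shows "C1_arc \<gamma> a b (\<lambda>t. tangent_norm c (\<gamma> t) (v t))"
proof -
  have "{a..b} \<inter> \<gamma> -` fst c = {a..b}"
    using assms by auto
  then have "C1_arc (id \<circ> \<gamma>) a b (\<lambda>t. tangent_norm c (\<gamma> t) (v t))"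
    using assms by (intro C1_arc_isometry_local[OF riemannian_isometry_id] bexI[of _ c] exI[of _ v]) auto
  then show ?thesis
    by simp
qed

text \<open>The speed is read off at each time in some chart around the point. Transition maps
  preserve norms, so around any time it is the speed in one fixed chart.\<close>

lemma C1_arc_of_curve:
  assumes "a < b" "C1_curve_on A a b \<gamma>"
  shows "\<exists>\<sigma>. C1_arc \<gamma> a b \<sigma>"
proof -
  define C where "C t = (SOME c. c \<in> A \<and> \<gamma> t \<in> fst c)" for t
  have C: "C t \<in> A" "\<gamma> t \<in> fst (C t)" for t
    using someI_ex[of "\<lambda>c. c \<in> A \<and> \<gamma> t \<in> fst c"] chart_at unfolding C_def by blast+
  define \<sigma> where "\<sigma> t = tangent_norm (C t) (\<gamma> t) (vector_derivative (snd (C t) \<circ> \<gamma>) (at t within {a..b}))" for t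
  have cont: "continuous_on {a..b} \<gamma>"
    using assms by (simp add: C1_curve_on_def)
  have "C1_arc (id \<circ> \<gamma>) a b \<sigma>"
  proof (rule C1_arc_isometry_local[OF riemannian_isometry_id \<open>a < b\<close> cont])
    fix t assume t: "t \<in> {a..b}"
    obtain v where v: "continuous_on ({a..b} \<inter> \<gamma> -` fst (C t)) v"
      "\<And>s. s \<in> {a..b} \<inter> \<gamma> -` fst (C t) \<Longrightarrow> ((snd (C t) \<circ> \<gamma>) has_vector_derivative v s) (at s within {a..b})"
      using assms C(1)[of t] unfolding C1_curve_on_def by blast
    have "\<sigma> s = tangent_norm (C t) (\<gamma> s) (v s)" if s: "s \<in> {a..b} \<inter> \<gamma> -` fst (C t)" for s
    proof -
      have s': "s \<in> {a..b}" "\<gamma> s \<in> fst (C t)" "id (\<gamma> s) \<in> fst (C s)"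
        using s C by auto
      note * = isometry_has_vector_derivative[OF riemannian_isometry_id C(1)[of t] C(1)[of s] s' cont v(2)[OF s]]
      have "vector_derivative (snd (C s) \<circ> \<gamma>) (at s within {a..b}) =
          jacobian (local_rep (C t) (C s) id) (snd (C t) (\<gamma> s)) *v v s"
        by (rule vector_derivative_within_closed_interval[OF \<open>a < b\<close> s'(1) *(1)[unfolded id_comp]])
      then show ?thesis
        using *(2) by (simp only: \<sigma>_def id_apply[of "\<gamma> s"])
    qed
    then show "\<exists>c\<in>A. \<exists>v. \<gamma> t \<in> fst c \<and> continuous_on ({a..b} \<inter> \<gamma> -` fst c) v \<and>
      (\<forall>s\<in>{a..b} \<inter> \<gamma> -` fst c. ((snd c \<circ> \<gamma>) has_vector_derivative v s) (at s within {a..b}) \<and>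
         \<sigma> s = tangent_norm c (\<gamma> s) (v s))"
      using C[of t] v by blast
  qed
  then show ?thesis
    by auto
qed

lemma C1_arc_curve: "C1_arc \<gamma> a b \<sigma> \<Longrightarrow> C1_curve_on A a b \<gamma>"
  unfolding C1_arc_def C1_curve_on_def by meson

text \<open>Around each time the speed is the norm of a continuous velocity in one chart. Continuity
  will make it integrable.\<close>

lemma C1_arc_speed:
  assumes "C1_arc \<gamma> a b \<sigma>"
  shows "continuous_on {a..b} \<sigma>" "\<And>t. t \<in> {a..b} \<Longrightarrow> 0 \<le> \<sigma> t"
proof -
  have cont: "continuous_on {a..b} \<gamma>"
    using assms by (rule C1_arcD)
  show "continuous_on {a..b} \<sigma>"
  proof (rule continuous_on_local)
    fix t assume t: "t \<in> {a..b}"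
    obtain c where c: "c \<in> A" "\<gamma> t \<in> fst c"
      using chart_at by blast
    obtain U where U: "open U" "\<And>s. s \<in> {a..b} \<Longrightarrow> s \<in> U \<longleftrightarrow> \<gamma> s \<in> fst c"
      using continuous_on_open_vimageE[OF cont open_chart[OF c(1)]] by blast
    obtain v where v: "continuous_on ({a..b} \<inter> \<gamma> -` fst c) v"
      "\<And>t. t \<in> {a..b} \<Longrightarrow> \<gamma> t \<in> fst c \<Longrightarrow> \<sigma> t = tangent_norm c (\<gamma> t) (v t)"
      using C1_arcE[OF assms c(1)] by metis
    have "continuous_on ({a..b} \<inter> \<gamma> -` fst c) (\<lambda>t. tangent_norm c (\<gamma> t) (v t))"
      using v(1) by (intro continuous_on_tangent_norm c continuous_on_subset[OF cont]) auto
    moreover have "{a..b} \<inter> \<gamma> -` fst c = {a..b} \<inter> U"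
      using U(2) by blast
    ultimately have "continuous_on ({a..b} \<inter> U) (\<lambda>t. tangent_norm c (\<gamma> t) (v t))"
      by simp
    then have "continuous_on ({a..b} \<inter> U) \<sigma>"
      using U(2) v(2) by (subst continuous_on_cong[OF refl v(2)]) auto
    then show "\<exists>U. open U \<and> t \<in> U \<and> continuous_on ({a..b} \<inter> U) \<sigma>"
      using U t c(2) by auto
  qed
  fix t assume t: "t \<in> {a..b}"
  obtain c where c: "c \<in> A" "\<gamma> t \<in> fst c"
    using chart_at by blast
  then show "0 \<le> \<sigma> t"
    using C1_arcE[OF assms c(1)] t tangent_norm_nonneg by metis
qed

lemma C1_arc_cong:
  assumes "C1_arc \<gamma> a b \<sigma>" and eq: "\<And>t. t \<in> {a..b} \<Longrightarrow> \<gamma>' t = \<gamma> t"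
  shows "C1_arc \<gamma>' a b \<sigma>"
  unfolding C1_arc_def
proof (intro conjI ballI)
  show "a < b" "continuous_on {a..b} \<gamma>'"
    using C1_arcD[OF assms(1)] by (simp_all only: continuous_on_cong[OF refl eq])
  fix c assume "c \<in> A"
  then obtain v where v: "continuous_on ({a..b} \<inter> \<gamma> -` fst c) v"
    "\<And>t. t \<in> {a..b} \<Longrightarrow> \<gamma> t \<in> fst c \<Longrightarrow> ((snd c \<circ> \<gamma>) has_vector_derivative v t) (at t within {a..b})"
    "\<And>t. t \<in> {a..b} \<Longrightarrow> \<gamma> t \<in> fst c \<Longrightarrow> \<sigma> t = tangent_norm c (\<gamma> t) (v t)"
    using C1_arcE[OF assms(1)] by blast
  have S: "{a..b} \<inter> \<gamma>' -` fst c = {a..b} \<inter> \<gamma> -` fst c"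
    using eq by auto
  show "\<exists>v. continuous_on ({a..b} \<inter> \<gamma>' -` fst c) v \<and> (\<forall>t\<in>{a..b} \<inter> \<gamma>' -` fst c.
      ((snd c \<circ> \<gamma>') has_vector_derivative v t) (at t within {a..b}) \<and>
           \<sigma> t = tangent_norm c (\<gamma>' t) (v t))"
  proof (intro exI[of _ v] conjI ballI)
    show "continuous_on ({a..b} \<inter> \<gamma>' -` fst c) v"
      using v(1) S by simp
    fix t assume "t \<in> {a..b} \<inter> \<gamma>' -` fst c"
    then have t: "t \<in> {a..b}" "\<gamma> t \<in> fst c"
      using S by auto
    show "((snd c \<circ> \<gamma>') has_vector_derivative v t) (at t within {a..b})"
      by (rule has_vector_derivative_transform[OF t(1) _ v(2)[OF t]]) (simp add: eq)
    show "\<sigma> t = tangent_norm c (\<gamma>' t) (v t)"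
      using v(3)[OF t] eq[OF t(1)] by simp
  qed
qed

text \<open>The slope \<open>m\<close> may be negative, whence the absolute value: rescaling and
  reversal of a curve are treated together.\<close>

lemma C1_arc_affine:
  fixes m k :: real
  defines "h \<equiv> \<lambda>t. m * t + k"
  assumes arc: "C1_arc \<gamma> a b \<sigma>" and "a' < b'" and h: "h ` {a'..b'} = {a..b}"
  shows "C1_arc (\<gamma> \<circ> h) a' b' (\<lambda>t. \<bar>m\<bar> * \<sigma> (h t))"
  unfolding C1_arc_def
proof (intro conjI ballI)
  show "a' < b'" by fact
  have cont_h: "continuous_on S h" for S
    unfolding h_def by (intro continuous_intros)
  show "continuous_on {a'..b'} (\<gamma> \<circ> h)"
    using C1_arcD[OF arc] h by (intro continuous_on_compose cont_h) auto
  fix c assume c: "c \<in> A"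
  obtain v where v: "continuous_on ({a..b} \<inter> \<gamma> -` fst c) v"
    "\<And>t. t \<in> {a..b} \<Longrightarrow> \<gamma> t \<in> fst c \<Longrightarrow> ((snd c \<circ> \<gamma>) has_vector_derivative v t) (at t within {a..b})"
    "\<And>t. t \<in> {a..b} \<Longrightarrow> \<gamma> t \<in> fst c \<Longrightarrow> \<sigma> t = tangent_norm c (\<gamma> t) (v t)"
    using C1_arcE[OF arc c] by blast
  let ?S = "{a'..b'} \<inter> (\<gamma> \<circ> h) -` fst c"
  show "\<exists>v. continuous_on ?S v \<and> (\<forall>t\<in>?S. ((snd c \<circ> (\<gamma> \<circ> h)) has_vector_derivative v t) (at t within {a'..b'}) \<and>
      \<bar>m\<bar> * \<sigma> (h t) = tangent_norm c ((\<gamma> \<circ> h) t) (v t))"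
  proof (intro exI[of _ "\<lambda>t. m *\<^sub>R v (h t)"] conjI ballI)
    show "continuous_on ?S (\<lambda>t. m *\<^sub>R v (h t))"
      using h by (intro continuous_intros continuous_on_compose2[OF v(1) cont_h]) auto
    fix t assume "t \<in> ?S"
    then have t: "h t \<in> {a..b}" "\<gamma> (h t) \<in> fst c"
      using h by auto
    have "(h has_vector_derivative m) (at t within {a'..b'})"
      unfolding h_def has_real_derivative_iff_has_vector_derivative[symmetric]
      by (auto intro!: derivative_eq_intros)
    then have "(((snd c \<circ> \<gamma>) \<circ> h) has_vector_derivative m *\<^sub>R v (h t)) (at t within {a'..b'})"
      using v(2)[OF t] h by (intro vector_diff_chain_within) simp_all
    then show "((snd c \<circ> (\<gamma> \<circ> h)) has_vector_derivative m *\<^sub>R v (h t)) (at t within {a'..b'})"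
      by (simp only: comp_assoc)
    show "\<bar>m\<bar> * \<sigma> (h t) = tangent_norm c ((\<gamma> \<circ> h) t) (m *\<^sub>R v (h t))"
      using v(3)[OF t] by (simp add: tangent_norm_scaleR)
  qed
qed

lemma C1_arc_subinterval:
  assumes arc: "C1_arc \<gamma> a b \<sigma>" and "a \<le> a'" "a' < b'" "b' \<le> b"
  shows "C1_arc \<gamma> a' b' \<sigma>"
  unfolding C1_arc_def
proof (intro conjI ballI)
  have sub: "{a'..b'} \<subseteq> {a..b}"
    using assms by auto
  show "a' < b'" by fact
  show "continuous_on {a'..b'} \<gamma>"
    using C1_arcD(2)[OF arc] sub by (rule continuous_on_subset)
  fix c assume c: "c \<in> A"
  obtain v where v: "continuous_on ({a..b} \<inter> \<gamma> -` fst c) v"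
    "\<And>t. t \<in> {a..b} \<Longrightarrow> \<gamma> t \<in> fst c \<Longrightarrow> ((snd c \<circ> \<gamma>) has_vector_derivative v t) (at t within {a..b})"
    "\<And>t. t \<in> {a..b} \<Longrightarrow> \<gamma> t \<in> fst c \<Longrightarrow> \<sigma> t = tangent_norm c (\<gamma> t) (v t)"
    using C1_arcE[OF arc c] by blast
  show "\<exists>v. continuous_on ({a'..b'} \<inter> \<gamma> -` fst c) v \<and> (\<forall>t\<in>{a'..b'} \<inter> \<gamma> -` fst c.
      ((snd c \<circ> \<gamma>) has_vector_derivative v t) (at t within {a'..b'}) \<and>
           \<sigma> t = tangent_norm c (\<gamma> t) (v t))"
    using sub v by (intro exI[of _ v] conjI ballI continuous_on_subset[OF v(1)]
        has_vector_derivative_within_subset[OF v(2) sub]) auto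
qed

section \<open>Concatenations of arcs and their length\<close>

inductive arc :: "(real \<Rightarrow> 'a) \<Rightarrow> real \<Rightarrow> real \<Rightarrow> real \<Rightarrow> bool" where
  arc_C1: "C1_arc \<gamma> a b \<sigma> \<Longrightarrow> (\<sigma> has_integral l) {a..b} \<Longrightarrow> arc \<gamma> a b l"
| arc_join: "arc \<gamma> a b l \<Longrightarrow> arc \<gamma> b c l' \<Longrightarrow> arc \<gamma> a c (l + l')"

lemma arc_less: "arc \<gamma> a b l \<Longrightarrow> a < b"
  by (induction rule: arc.induct) (auto dest: C1_arcD)

lemma arc_nonneg: "arc \<gamma> a b l \<Longrightarrow> 0 \<le> l"
  by (induction rule: arc.induct) (auto intro: has_integral_nonneg C1_arc_speed)

lemma arc_continuous: "arc \<gamma> a b l \<Longrightarrow> continuous_on {a..b} \<gamma>"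
proof (induction rule: arc.induct)
  case (arc_join \<gamma> a b l c l')
  have "{a..c} = {a..b} \<union> {b..c}"
    using arc_join.hyps[THEN arc_less] by auto
  then show ?case
    using arc_join.IH by (auto intro: continuous_on_closed_Un)
qed (rule C1_arcD)

lemma C1_arc_imp_arc: "C1_arc \<gamma> a b \<sigma> \<Longrightarrow> arc \<gamma> a b (integral {a..b} \<sigma>)"
  by (rule arc_C1, assumption, intro integrable_integral integrable_continuous_interval C1_arc_speed(1))

lemma arc_cong: "arc \<gamma> a b l \<Longrightarrow> (\<And>t. t \<in> {a..b} \<Longrightarrow> \<gamma>' t = \<gamma> t) \<Longrightarrow> arc \<gamma>' a b l"
proof (induction rule: arc.induct)
  case (arc_C1 \<gamma> a b \<sigma> l)
  then show ?case
    by (blast intro: arc.arc_C1 C1_arc_cong)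
next
  case (arc_join \<gamma> a b l c l')
  then show ?case
    using arc_join.hyps[THEN arc_less] by (intro arc.arc_join) auto
qed

lemma arc_isometry: "arc \<gamma> a b l \<Longrightarrow> riemannian_isometry A g f \<Longrightarrow> arc (f \<circ> \<gamma>) a b l"
  by (induction rule: arc.induct) (auto intro: arc_C1 arc_join C1_arc_isometry)

text \<open>The factor \<open>\<bar>m\<bar>\<close> in the speed cancels the factor
  \<open>1 / \<bar>m\<bar>\<close> of the substitution, so the length is unchanged.\<close>

lemma C1_arc_affine_arc:
  fixes m k :: real
  assumes "C1_arc \<gamma> a b \<sigma>" "(\<sigma> has_integral l) {a..b}" and "m \<noteq> 0" "a' < b'"
    and h: "(\<lambda>t. m * t + k) ` {a'..b'} = {a..b}"
  shows "arc (\<lambda>t. \<gamma> (m * t + k)) a' b' l"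
proof (rule arc_C1)
  show "C1_arc (\<lambda>t. \<gamma> (m * t + k)) a' b' (\<lambda>t. \<bar>m\<bar> * \<sigma> (m * t + k))"
    using C1_arc_affine[OF assms(1,4) h] by (simp add: comp_def)
  have "((\<lambda>t. \<sigma> (m * t + k)) has_integral l / \<bar>m\<bar>) ((\<lambda>x. (1 / m) *\<^sub>R x + - ((1 / m) *\<^sub>R k)) ` {a..b})"
    using has_integral_affinity[of \<sigma> l a b m k] assms by simp
  also have "(\<lambda>x. (1 / m) *\<^sub>R x + - ((1 / m) *\<^sub>R k)) ` {a..b} = {a'..b'}"
    using \<open>m \<noteq> 0\<close> by (simp only: h[symmetric] image_image) (simp add: field_simps)
  finally show "((\<lambda>t. \<bar>m\<bar> * \<sigma> (m * t + k)) has_integral l) {a'..b'}"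
    using has_integral_mult_right[of "\<lambda>t. \<sigma> (m * t + k)" "l / \<bar>m\<bar>" "{a'..b'}" "\<bar>m\<bar>"] \<open>m \<noteq> 0\<close>
    by simp
qed

lemma arc_affine:
  "arc \<gamma> a b l \<Longrightarrow> 0 < m \<Longrightarrow> arc (\<lambda>t. \<gamma> (m * t + k)) ((a - k) / m) ((b - k) / m) l"
proof (induction rule: arc.induct)
  case (arc_C1 \<gamma> a b \<sigma> l)
  have "(\<lambda>t. m * t + k) ` {(a - k) / m..(b - k) / m} = {a..b}"
    using \<open>0 < m\<close> C1_arcD(1)[OF arc_C1(1)] by (subst image_affinity_atLeastAtMost) (auto simp: field_simps)
  then show ?case
    using arc_C1 C1_arcD(1)[OF arc_C1(1)] by (intro C1_arc_affine_arc[OF arc_C1(1,2)]) (auto simp: divide_strict_right_mono)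
qed (auto intro: arc_join)

lemma arc_reverse: "arc \<gamma> a b l \<Longrightarrow> arc (\<lambda>t. \<gamma> (- t)) (- b) (- a) l"
proof (induction rule: arc.induct)
  case (arc_C1 \<gamma> a b \<sigma> l)
  have "(\<lambda>t. (- 1) * t + 0) ` {- b..- a} = {a..b}"
    using C1_arcD(1)[OF arc_C1(1)] by simp
  from C1_arc_affine_arc[OF arc_C1 _ _ this] show ?case
    using C1_arcD(1)[OF arc_C1(1)] by simp
next
  case (arc_join \<gamma> a b l c l')
  then show ?case
    using arc.arc_join[of "\<lambda>t. \<gamma> (- t)" "- c" "- b" l' "- a" l] by (simp add: add.commute)
qed

text \<open>A C1 piece is cut by additivity of the integral, a concatenation by locating
  \<open>s\<close> relative to the junction. This is how curves are stopped at a chosen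
  time.\<close>

lemma arc_split:
  "arc \<gamma> a b l \<Longrightarrow> a < s \<Longrightarrow> s < b \<Longrightarrow> \<exists>l1 l2. l = l1 + l2 \<and> arc \<gamma> a s l1 \<and> arc \<gamma> s b l2"
proof (induction rule: arc.induct)
  case (arc_C1 \<gamma> a b \<sigma> l)
  have "C1_arc \<gamma> a s \<sigma>" "C1_arc \<gamma> s b \<sigma>"
    using arc_C1 by (auto intro: C1_arc_subinterval)
  then have "arc \<gamma> a s (integral {a..s} \<sigma>)" "arc \<gamma> s b (integral {s..b} \<sigma>)"
    by (auto intro: C1_arc_imp_arc)
  moreover have "l = integral {a..s} \<sigma> + integral {s..b} \<sigma>"
    using arc_C1 Henstock_Kurzweil_Integration.integral_combine[where a = a and c = s and b = b and f = \<sigma>] by (simp add: has_integral_iff)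
  ultimately show ?case
    by blast
next
  case (arc_join \<gamma> a b l c l')
  consider "s < b" | "s = b" | "b < s"
    by linarith
  then show ?case
  proof cases
    case 1
    then obtain l1 l2 where "l = l1 + l2" "arc \<gamma> a s l1" "arc \<gamma> s b l2"
      using arc_join by blast
    then show ?thesis
      using arc_join.hyps arc.arc_join[of \<gamma> s b l2 c l'] by (metis add.assoc)
  next
    case 2
    then show ?thesis
      using arc_join.hyps by blast
  next
    case 3
    then obtain l1 l2 where "l' = l1 + l2" "arc \<gamma> b s l1" "arc \<gamma> s c l2"
      using arc_join by blast
    then show ?thesis
      using arc_join.hyps arc.arc_join[of \<gamma> a b l s l1] by (metis add.assoc)
  qed
qed

text \<open>At interior times of a piece the derivative within the interval is the two-sided one,
  and finitely many times do not affect the integral. In particular the curve determines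
  \<open>l\<close>.\<close>

lemma arc_curve_speed: "arc \<gamma> a b l \<Longrightarrow> (curve_speed A g \<gamma> has_integral l) {a..b}"
proof (induction rule: arc.induct)
  case (arc_C1 \<gamma> a b \<sigma> l)
  have "curve_speed A g \<gamma> t = \<sigma> t" if "t \<in> {a..b} - {a, b}" for t
  proof -
    define c where "c = (SOME c. c \<in> A \<and> \<gamma> t \<in> fst c)"
    have c: "c \<in> A" "\<gamma> t \<in> fst c"
      using someI_ex[of "\<lambda>c. c \<in> A \<and> \<gamma> t \<in> fst c"] chart_at unfolding c_def by blast+
    have t: "t \<in> {a..b}"
      using that by auto
    obtain w where w: "((snd c \<circ> \<gamma>) has_vector_derivative w) (at t within {a..b})"
      "\<sigma> t = tangent_norm c (\<gamma> t) w"
      using C1_arcE[OF arc_C1(1) c(1)] t c(2) by metis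
    have "at t within {a..b} = at t"
      using that by (intro at_within_interior) auto
    then have "vector_derivative (snd c \<circ> \<gamma>) (at t) = w"
      using w(1) by (simp add: vector_derivative_at)
    then show ?thesis
      using w(2) by (simp add: curve_speed_def c_def[symmetric] Let_def tangent_norm_def)
  qed
  then show ?case
    by (intro has_integral_spike_finite[OF _ _ arc_C1(2), of "{a, b}"]) auto
next
  case (arc_join \<gamma> a b l c l')
  then show ?case
    using arc_join.hyps[THEN arc_less] by (intro has_integral_combine[where a = a and c = b and b = c]) auto
qed

lemma piecewise_C1_curve_iff_arc: "piecewise_C1_curve A \<gamma> \<longleftrightarrow> (\<exists>l. arc \<gamma> 0 1 l)"
proof
  assume "piecewise_C1_curve A \<gamma>"
  then obtain m \<tau> where \<tau>: "\<tau> 0 = 0" "\<tau> m = 1"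
    and C1: "\<And>i. i < m \<Longrightarrow> \<tau> i < \<tau> (Suc i) \<and> C1_curve_on A (\<tau> i) (\<tau> (Suc i)) \<gamma>"
    unfolding piecewise_C1_curve_def by blast
  have piece: "\<exists>l. arc \<gamma> (\<tau> i) (\<tau> (Suc i)) l" if "i < m" for i
    using C1[OF that] C1_arc_of_curve C1_arc_imp_arc by blast
  have pieces: "i < m \<Longrightarrow> \<exists>l. arc \<gamma> (\<tau> 0) (\<tau> (Suc i)) l" for i
  proof (induction i)
    case 0
    then show ?case using piece by blast
  next
    case (Suc i)
    then obtain l l' where "arc \<gamma> (\<tau> 0) (\<tau> (Suc i)) l" "arc \<gamma> (\<tau> (Suc i)) (\<tau> (Suc (Suc i))) l'"
      using piece[of "Suc i"] by auto
    then show ?case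
      using arc_join by blast
  qed
  \<comment> \<open>The endpoints 0 and 1 differ, so the subdivision has at least one
    interval.\<close>
  obtain k where "m = Suc k"
    using \<tau> by (cases m) auto
  then show "\<exists>l. arc \<gamma> 0 1 l"
    using \<tau> pieces[of k] by simp
next
  have "\<exists>m \<tau>. \<tau> 0 = a \<and> \<tau> m = b \<and>
      (\<forall>i<m. \<tau> i < \<tau> (Suc i) \<and> C1_curve_on A (\<tau> i) (\<tau> (Suc i)) \<gamma>)" if "arc \<gamma> a b l" for a b l
    using that
  proof (induction rule: arc.induct)
    case (arc_C1 \<gamma> a b \<sigma> l)
    then show ?case
      using C1_arcD(1) C1_arc_curve
      by (intro exI[of _ "Suc 0"] exI[of _ "\<lambda>i. if i = 0 then a else b"]) auto
  next
    case (arc_join \<gamma> a b l c l')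
    obtain m \<tau> where 1: "\<tau> 0 = a" "\<tau> m = b"
      "\<And>i. i < m \<Longrightarrow> \<tau> i < \<tau> (Suc i) \<and> C1_curve_on A (\<tau> i) (\<tau> (Suc i)) \<gamma>"
      using arc_join.IH(1) by blast
    obtain m' \<tau>' where 2: "\<tau>' 0 = b" "\<tau>' m' = c"
      "\<And>i. i < m' \<Longrightarrow> \<tau>' i < \<tau>' (Suc i) \<and> C1_curve_on A (\<tau>' i) (\<tau>' (Suc i)) \<gamma>"
      using arc_join.IH(2) by blast
    \<comment> \<open>At the seam, index \<open>m\<close>, both subdivisions have the value
      \<open>b\<close>, so \<open>\<rho>\<close> may switch there.\<close>
    define \<rho> where "\<rho> i = (if i < m then \<tau> i else \<tau>' (i - m))" for i
    have "\<rho> i < \<rho> (Suc i) \<and> C1_curve_on A (\<rho> i) (\<rho> (Suc i)) \<gamma>" if "i < m + m'" for i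
    proof (cases "i < m")
      case True
      then have "\<rho> i = \<tau> i" "\<rho> (Suc i) = \<tau> (Suc i)"
        using 1(2) 2(1) by (auto simp: \<rho>_def not_less le_Suc_eq)
      then show ?thesis
        using 1(3)[OF True] by simp
    next
      case False
      then show ?thesis
        using 2(3)[of "i - m"] that by (simp add: \<rho>_def Suc_diff_le)
    qed
    moreover have "\<rho> 0 = a" "\<rho> (m + m') = c"
      using 1 2 by (auto simp: \<rho>_def)
    ultimately show ?case
      by blast
  qed
  then show "piecewise_C1_curve A \<gamma>" if "\<exists>l. arc \<gamma> 0 1 l"
    using that unfolding piecewise_C1_curve_def by blast
qed

section \<open>The distance as an infimum of joinable lengths\<close>

definition joinable :: "'a \<Rightarrow> 'a \<Rightarrow> real \<Rightarrow> bool" where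
  "joinable x y l \<longleftrightarrow> (\<exists>\<gamma> a b. arc \<gamma> a b l \<and> \<gamma> a = x \<and> \<gamma> b = y)"

text \<open>\<open>joinable\<close> leaves the parameter interval free, which suits reversal and
  concatenation; the definition of the distance uses \<open>[0, 1]\<close>, which an affine change
  of parameter restores.\<close>

lemma joinable_unit:
  assumes "joinable x y l"
  shows "\<exists>\<gamma>. arc \<gamma> 0 1 l \<and> \<gamma> 0 = x \<and> \<gamma> 1 = y"
proof -
  obtain \<gamma> a b where \<gamma>: "arc \<gamma> a b l" "\<gamma> a = x" "\<gamma> b = y"
    using assms unfolding joinable_def by blast
  then have "arc (\<lambda>t. \<gamma> ((b - a) * t + a)) 0 1 l"
    using arc_affine[of \<gamma> a b l "b - a" a] arc_less[of \<gamma> a b l] by simp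
  then show ?thesis
    using \<gamma> by (intro exI[of _ "\<lambda>t. \<gamma> ((b - a) * t + a)"]) simp
qed

lemma riemannian_dist_joinable: "riemannian_dist A g x y = Inf {l. joinable x y l}"
proof -
  have "{curve_length A g \<gamma> |\<gamma>. piecewise_C1_curve A \<gamma> \<and> \<gamma> 0 = x \<and> \<gamma> 1 = y} = {l. joinable x y l}"
  proof safe
    fix \<gamma> assume "piecewise_C1_curve A \<gamma>"
    then obtain l where "arc \<gamma> 0 1 l"
      by (auto simp: piecewise_C1_curve_iff_arc)
    moreover from this have "curve_length A g \<gamma> = l"
      unfolding curve_length_def by (intro integral_unique arc_curve_speed)
    ultimately show "joinable (\<gamma> 0) (\<gamma> 1) (curve_length A g \<gamma>)"
      by (auto simp: joinable_def)
  next
    fix l assume "joinable x y l"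
    then obtain \<gamma> where \<gamma>: "arc \<gamma> 0 1 l" "\<gamma> 0 = x" "\<gamma> 1 = y"
      using joinable_unit by blast
    then have "curve_length A g \<gamma> = l"
      unfolding curve_length_def by (intro integral_unique arc_curve_speed)
    then show "\<exists>\<gamma>. l = curve_length A g \<gamma> \<and> piecewise_C1_curve A \<gamma> \<and> \<gamma> 0 = x \<and> \<gamma> 1 = y"
      using \<gamma> by (auto simp: piecewise_C1_curve_iff_arc)
  qed
  then show ?thesis
    by (simp add: riemannian_dist_def)
qed

lemma arc_joinable: "arc \<gamma> a b l \<Longrightarrow> \<gamma> a = x \<Longrightarrow> \<gamma> b = y \<Longrightarrow> joinable x y l"
  unfolding joinable_def by blast

lemma joinable_nonneg: "joinable x y l \<Longrightarrow> 0 \<le> l"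
  by (auto simp: joinable_def intro: arc_nonneg)

lemma joinable_sym: "joinable x y l \<Longrightarrow> joinable y x l"
  unfolding joinable_def
proof (elim exE conjE)
  fix \<gamma> a b assume "arc \<gamma> a b l" "\<gamma> a = x" "\<gamma> b = y"
  then show "\<exists>\<gamma> a b. arc \<gamma> a b l \<and> \<gamma> a = y \<and> \<gamma> b = x"
    by (intro exI[of _ "\<lambda>t. \<gamma> (- t)"] exI[of _ "- b"] exI[of _ "- a"]) (simp add: arc_reverse)
qed

lemma joinable_trans:
  assumes "joinable x y l" "joinable y z l'"
  shows "joinable x z (l + l')"
proof -
  obtain \<gamma> where \<gamma>: "arc \<gamma> 0 1 l" "\<gamma> 0 = x" "\<gamma> 1 = y"
    using joinable_unit[OF assms(1)] by blast
  obtain \<gamma>' where \<gamma>': "arc \<gamma>' 0 1 l'" "\<gamma>' 0 = y" "\<gamma>' 1 = z"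
    using joinable_unit[OF assms(2)] by blast
  define \<delta> where "\<delta> t = (if t \<le> 1 then \<gamma> t else \<gamma>' (t - 1))" for t
  have "arc (\<lambda>t. \<gamma>' (t - 1)) 1 2 l'"
    using arc_affine[OF \<gamma>'(1), of 1 "- 1"] by simp
  then have "arc \<delta> 1 2 l'"
    by (rule arc_cong) (use \<gamma> \<gamma>' in \<open>auto simp: \<delta>_def\<close>)
  moreover have "arc \<delta> 0 1 l"
    by (rule arc_cong[OF \<gamma>(1)]) (auto simp: \<delta>_def)
  ultimately have "arc \<delta> 0 2 (l + l')"
    by (rule arc_join[rotated])
  moreover have "\<delta> 0 = x" "\<delta> 2 = z"
    using \<gamma> \<gamma>' by (auto simp: \<delta>_def)
  ultimately show ?thesis
    unfolding joinable_def by blast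
qed

lemma joinable_isometry: "joinable x y l \<Longrightarrow> riemannian_isometry A g f \<Longrightarrow> joinable (f x) (f y) l"
  unfolding joinable_def
proof (elim exE conjE)
  fix \<gamma> a b assume "riemannian_isometry A g f" "arc \<gamma> a b l" "\<gamma> a = x" "\<gamma> b = y"
  then show "\<exists>\<gamma> a b. arc \<gamma> a b l \<and> \<gamma> a = f x \<and> \<gamma> b = f y"
    by (intro exI[of _ "f \<circ> \<gamma>"] exI[of _ a] exI[of _ b]) (simp add: arc_isometry)
qed

end

lemma norm_scaleR_sgn: "norm w *\<^sub>R sgn w = (w :: 'a::real_normed_vector)"
  by (cases "w = 0") (simp_all add: sgn_div_norm)

section \<open>Riemannian and Euclidean lengths in a chart\<close>

context riemannian
begin

abbreviation d :: "'a \<Rightarrow> 'a \<Rightarrow> real" where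
  "d \<equiv> riemannian_dist A g"

lemma riemannian_dist_le: "joinable x y l \<Longrightarrow> d x y \<le> l"
  unfolding riemannian_dist_joinable
  by (intro cInf_lower bdd_belowI[of _ 0]) (auto intro: joinable_nonneg)

lemma continuous_on_tangent_norm_pair:
  assumes "c \<in> A" "S \<subseteq> snd c ` fst c"
  shows "continuous_on (S \<times> W) (\<lambda>z. tangent_norm c (chart_inv c (fst z)) (snd z))"
proof -
  have "continuous_on (S \<times> W) (\<lambda>z. chart_inv c (fst z))"
    using assms(2) by (intro continuous_on_compose2[OF continuous_chart_inv[OF \<open>c \<in> A\<close>]] continuous_intros) auto
  then show ?thesis
    using assms by (intro continuous_on_tangent_norm continuous_intros) auto
qed

text \<open>The norm is continuous, hence bounded, on the compact set
  \<open>K \<times> cball 0 1\<close>, and it scales with \<open>w\<close>.\<close>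

lemma tangent_norm_upper_bound:
  assumes "c \<in> A" "compact K" "K \<subseteq> snd c ` fst c"
  obtains C where "\<And>x w. x \<in> K \<Longrightarrow> tangent_norm c (chart_inv c x) w \<le> C * norm w"
proof -
  let ?f = "\<lambda>z. tangent_norm c (chart_inv c (fst z)) (snd z)"
  have "compact (?f ` (K \<times> cball 0 1))"
    using assms by (intro compact_continuous_image continuous_on_tangent_norm_pair compact_Times) auto
  then have "bounded (?f ` (K \<times> cball 0 1))"
    by (rule compact_imp_bounded)
  then obtain C where "\<forall>y \<in> ?f ` (K \<times> cball 0 1). norm y \<le> C"
    unfolding bounded_iff by (elim exE)
  then have C: "norm (?f z) \<le> C" if "z \<in> K \<times> cball 0 1" for z
    using that by blast
  have "tangent_norm c (chart_inv c x) w \<le> C * norm w" if "x \<in> K" for x w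
  proof -
    have "tangent_norm c (chart_inv c x) (norm w *\<^sub>R sgn w) =
        norm w * tangent_norm c (chart_inv c x) (sgn w)"
      by (simp only: tangent_norm_scaleR abs_norm_cancel)
    also have "\<dots> \<le> norm w * C"
    proof (intro mult_left_mono norm_ge_zero)
      have "norm (sgn w) \<le> 1"
        by (simp add: norm_sgn)
      then show "tangent_norm c (chart_inv c x) (sgn w) \<le> C"
        using C[of "(x, sgn w)"] that by simp
    qed
    also have "norm w *\<^sub>R sgn w = w"
      by (rule norm_scaleR_sgn)
    finally show ?thesis
      by (simp add: mult.commute)
  qed
  then show ?thesis
    using that by blast
qed

text \<open>Over \<open>K\<close> and the unit vectors the minimum is attained, hence positive. With
  the upper bound, Riemannian and Euclidean norms are equivalent on compact parts of a
  chart.\<close>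

lemma tangent_norm_lower_bound:
  assumes "c \<in> A" "compact K" "K \<subseteq> snd c ` fst c"
  obtains \<epsilon> where "\<epsilon> > 0" "\<And>x w. x \<in> K \<Longrightarrow> \<epsilon> * norm w \<le> tangent_norm c (chart_inv c x) w"
proof (cases "K = {}")
  case False
  let ?f = "\<lambda>z. tangent_norm c (chart_inv c (fst z)) (snd z)"
  \<comment> \<open>A basis vector shows that the unit sphere is nonempty, as the existence of a
    minimum demands.\<close>
  obtain b :: "real ^ 'n" where "b \<in> Basis"
    using nonempty_Basis by blast
  then have ne: "K \<times> sphere 0 1 \<noteq> ({} :: ((real ^ 'n) \<times> (real ^ 'n)) set)"
    using False norm_Basis[of b] by auto
  have "compact (K \<times> sphere (0 :: real ^ 'n) 1)"
    using assms by (intro compact_Times) auto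
  then obtain z where z: "z \<in> K \<times> sphere 0 1" "\<And>y. y \<in> K \<times> sphere 0 1 \<Longrightarrow> ?f z \<le> ?f y"
    using continuous_attains_inf[OF _ ne continuous_on_tangent_norm_pair[OF assms(1,3)]] by blast
  have fst_z: "fst z \<in> snd c ` fst c" and snd_z: "snd z \<noteq> 0"
    using z(1) assms(3) by auto
  have "?f z > 0"
    by (rule tangent_norm_pos[OF assms(1) chart_inv_in[OF fst_z] snd_z])
  moreover have "?f z * norm w \<le> tangent_norm c (chart_inv c x) w" if "x \<in> K" for x w
  proof (cases "w = 0")
    case False
    have "norm w * ?f z \<le> norm w * tangent_norm c (chart_inv c x) (sgn w)"
      using z(2)[of "(x, sgn w)"] that False by (intro mult_left_mono) (auto simp: norm_sgn)
    also have "\<dots> = tangent_norm c (chart_inv c x) (norm w *\<^sub>R sgn w)"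
      by (simp only: tangent_norm_scaleR abs_norm_cancel)
    also have "norm w *\<^sub>R sgn w = w"
      by (rule norm_scaleR_sgn)
    finally show ?thesis
      by (simp add: mult.commute)
  qed (simp add: tangent_norm_def)
  ultimately show ?thesis
    using that by blast
qed (use that[of 1] in auto)

text \<open>\<open>V\<close> leaves room for a further condition on the ball, such as avoiding a
  given point.\<close>

lemma chart_cball:
  assumes "c \<in> A" "p \<in> fst c" "open V" "p \<in> V"
  obtains r where "r > 0" "cball (snd c p) r \<subseteq> snd c ` (fst c \<inter> V)"
proof -
  have "snd c ` (fst c \<inter> V) = snd c ` fst c \<inter> chart_inv c -` V"
    using assms(1) by force
  moreover have "open (snd c ` fst c \<inter> chart_inv c -` V)"
    using assms by (intro continuous_open_preimage continuous_chart_inv open_chart_image)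
  ultimately have "open (snd c ` (fst c \<inter> V))"
    by simp
  moreover have "snd c p \<in> snd c ` (fst c \<inter> V)"
    using assms by blast
  ultimately obtain r where "r > 0" "cball (snd c p) r \<subseteq> snd c ` (fst c \<inter> V)"
    unfolding open_contains_cball by blast
  then show ?thesis
    by (rule that)
qed

lemma open_chart_ball:
  assumes "c \<in> A"
  shows "open (fst c \<inter> snd c -` ball x r)"
  using assms by (intro continuous_open_preimage continuous_chart open_chart) auto

text \<open>The curve is the straight coordinate segment within a ball around \<open>p\<close>. The
  case \<open>q = p\<close> is included: there the bound is 0, which later gives
  \<open>d x x = 0\<close>.\<close>

lemma joinable_local:
  assumes "c \<in> A" "p \<in> fst c"
  shows "\<exists>U C. open U \<and> p \<in> U \<and> U \<subseteq> fst c \<and>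
    (\<forall>q\<in>U. \<exists>l. joinable p q l \<and> l \<le> C * norm (snd c q - snd c p))"
proof -
  obtain r where r: "r > 0" "cball (snd c p) r \<subseteq> snd c ` fst c"
    using chart_cball[OF assms open_UNIV UNIV_I] by auto
  obtain C where C: "\<And>x w. x \<in> cball (snd c p) r \<Longrightarrow> tangent_norm c (chart_inv c x) w \<le> C * norm w"
    using tangent_norm_upper_bound[OF assms(1) compact_cball r(2)] by blast
  show ?thesis
  proof (rule exI[of _ "fst c \<inter> snd c -` ball (snd c p) r"], rule exI[of _ C], intro conjI ballI)
    show "open (fst c \<inter> snd c -` ball (snd c p) r)"
      by (rule open_chart_ball[OF assms(1)])
    show "p \<in> fst c \<inter> snd c -` ball (snd c p) r" "fst c \<inter> snd c -` ball (snd c p) r \<subseteq> fst c"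
      using assms r by auto
    fix q assume q: "q \<in> fst c \<inter> snd c -` ball (snd c p) r"
    define w where "w = snd c q - snd c p"
    define x where "x t = snd c p + t *\<^sub>R w" for t
    define \<gamma> where "\<gamma> t = chart_inv c (x t)" for t
    have x: "x t \<in> cball (snd c p) r" if "t \<in> {0..1}" for t
    proof -
      have "norm (t *\<^sub>R w) \<le> 1 * norm w"
        using that by (simp add: mult_left_le_one_le)
      also have "\<dots> \<le> r"
        using q by (simp add: w_def dist_norm norm_minus_commute)
      finally show ?thesis
        by (simp add: x_def dist_norm)
    qed
    have cont: "continuous_on {0..1} \<gamma>"
      unfolding \<gamma>_def x_def using x r(2) unfolding x_def
      by (intro continuous_on_compose2[OF continuous_chart_inv[OF assms(1)]] continuous_intros) auto
    have der: "((snd c \<circ> \<gamma>) has_vector_derivative w) (at t within {0..1})" if "t \<in> {0..1}" for t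
    proof (rule has_vector_derivative_transform[OF that])
      show "(x has_vector_derivative w) (at t within {0..1})"
        unfolding x_def by (auto intro!: derivative_eq_intros)
      show "(snd c \<circ> \<gamma>) s = x s" if "s \<in> {0..1}" for s
        using x[OF that] r(2) by (auto simp: \<gamma>_def)
    qed
    have "\<gamma> t \<in> fst c" if "t \<in> {0..1}" for t
      unfolding \<gamma>_def by (rule chart_inv_in[OF subsetD[OF r(2) x[OF that]]])
    then have "C1_arc \<gamma> 0 1 (\<lambda>t. tangent_norm c (\<gamma> t) w)"
      using assms(1) cont der by (intro C1_arc_in_chart) auto
    then have arc: "arc \<gamma> 0 1 (integral {0..1} (\<lambda>t. tangent_norm c (\<gamma> t) w))"
      and cont_speed: "continuous_on {0..1} (\<lambda>t. tangent_norm c (\<gamma> t) w)"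
      by (rule C1_arc_imp_arc, rule C1_arc_speed)
    have "integral {0..1} (\<lambda>t. tangent_norm c (\<gamma> t) w) \<le> integral {0..1::real} (\<lambda>t. C * norm w)"
      using C x by (intro integral_le integrable_continuous_interval cont_speed) (auto simp: \<gamma>_def)
    moreover have "\<gamma> 0 = p" "\<gamma> 1 = q"
      using assms q by (auto simp: \<gamma>_def x_def w_def)
    ultimately show "\<exists>l. joinable p q l \<and> l \<le> C * norm (snd c q - snd c p)"
      using arc by (intro exI[of _ "integral {0..1} (\<lambda>t. tangent_norm c (\<gamma> t) w)"])
        (auto simp: joinable_def w_def)
  qed
qed

text \<open>On a C1 piece the coordinate displacement is the integral of the velocity, and
  \<open>\<epsilon>\<close> times the norm of the velocity is at most the speed. Pieces are combined
  by the triangle inequality.\<close>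

lemma arc_chart_length:
  assumes "c \<in> A" "0 < \<epsilon>" and low: "\<And>p w. p \<in> K \<Longrightarrow> \<epsilon> * norm w \<le> tangent_norm c p w" and "K \<subseteq> fst c"
  shows "arc \<gamma> a b l \<Longrightarrow> \<gamma> ` {a..b} \<subseteq> K \<Longrightarrow> \<epsilon> * norm (snd c (\<gamma> b) - snd c (\<gamma> a)) \<le> l"
proof (induction rule: arc.induct)
  case (arc_C1 \<gamma> a b \<sigma> l)
  have K: "\<gamma> t \<in> K" "\<gamma> t \<in> fst c" if "t \<in> {a..b}" for t
    using arc_C1(3) \<open>K \<subseteq> fst c\<close> that by blast+
  obtain v where v: "\<And>t. t \<in> {a..b} \<Longrightarrow> ((snd c \<circ> \<gamma>) has_vector_derivative v t) (at t within {a..b})"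
    "\<And>t. t \<in> {a..b} \<Longrightarrow> \<sigma> t = tangent_norm c (\<gamma> t) (v t)"
    using C1_arcE[OF arc_C1(1) \<open>c \<in> A\<close>] K by metis
  have I: "(v has_integral (snd c \<circ> \<gamma>) b - (snd c \<circ> \<gamma>) a) {a..b}"
    by (rule fundamental_theorem_of_calculus[OF less_imp_le[OF C1_arcD(1)[OF arc_C1(1)]] v(1)])
  have "((\<lambda>t. \<epsilon> *\<^sub>R v t) has_integral \<epsilon> *\<^sub>R ((snd c \<circ> \<gamma>) b - (snd c \<circ> \<gamma>) a)) {a..b}"
    using I by (rule has_integral_cmul)
  moreover have "norm (integral {a..b} (\<lambda>t. \<epsilon> *\<^sub>R v t)) \<le> integral {a..b} \<sigma>"
    using calculation arc_C1(2) low K v(2) \<open>0 < \<epsilon>\<close>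
    by (intro integral_norm_bound_integral has_integral_integrable) auto
  ultimately have "norm (\<epsilon> *\<^sub>R ((snd c \<circ> \<gamma>) b - (snd c \<circ> \<gamma>) a)) \<le> l"
    using arc_C1(2) by (simp only: has_integral_iff)
  then show ?case
    using \<open>0 < \<epsilon>\<close> by simp
next
  case (arc_join \<gamma> a b l c' l')
  have "{a..b} \<subseteq> {a..c'}" "{b..c'} \<subseteq> {a..c'}"
    using arc_join.hyps[THEN arc_less] by auto
  then have "\<epsilon> * norm (snd c (\<gamma> b) - snd c (\<gamma> a)) \<le> l" "\<epsilon> * norm (snd c (\<gamma> c') - snd c (\<gamma> b)) \<le> l'"
    using arc_join.IH arc_join.prems by (meson image_mono order_trans)+
  moreover have "norm (snd c (\<gamma> c') - snd c (\<gamma> a)) \<le>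
      norm (snd c (\<gamma> b) - snd c (\<gamma> a)) + norm (snd c (\<gamma> c') - snd c (\<gamma> b))"
    using norm_triangle_ineq[of "snd c (\<gamma> b) - snd c (\<gamma> a)" "snd c (\<gamma> c') - snd c (\<gamma> b)"] by simp
  then have "\<epsilon> * norm (snd c (\<gamma> c') - snd c (\<gamma> a)) \<le>
      \<epsilon> * norm (snd c (\<gamma> b) - snd c (\<gamma> a)) + \<epsilon> * norm (snd c (\<gamma> c') - snd c (\<gamma> b))"
    using \<open>0 < \<epsilon>\<close> by (simp add: distrib_left[symmetric])
  ultimately show ?case
    by linarith
qed

text \<open>A curve from \<open>x\<close> to \<open>y\<close> has to leave a coordinate ball around \<open>x\<close> not containing \<open>y\<close>.\<close>

lemma joinable_lower_bound:
  assumes "x \<noteq> y"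
  obtains \<epsilon> where "\<epsilon> > 0" "\<And>l. joinable x y l \<Longrightarrow> \<epsilon> \<le> l"
proof -
  obtain c where c: "c \<in> A" "x \<in> fst c"
    using chart_at by blast
  obtain r where r: "r > 0" "cball (snd c x) r \<subseteq> snd c ` (fst c \<inter> - {y})"
    using chart_cball[OF c, of "- {y}"] assms by auto
  define K where "K = chart_inv c ` cball (snd c x) r"
  have r': "cball (snd c x) r \<subseteq> snd c ` fst c"
    using r(2) by auto
  have K: "p \<in> K \<longleftrightarrow> p \<in> fst c \<and> snd c p \<in> cball (snd c x) r" for p
  proof
    assume "p \<in> K"
    then obtain z where z: "z \<in> cball (snd c x) r" "p = chart_inv c z"
      by (auto simp only: K_def)
    then have "z \<in> snd c ` fst c"
      using r' by blast
    then show "p \<in> fst c \<and> snd c p \<in> cball (snd c x) r"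
      using z by (simp only: chart_inv_in chart_chart_inv simp_thms)
  next
    assume "p \<in> fst c \<and> snd c p \<in> cball (snd c x) r"
    then show "p \<in> K"
      using c(1) unfolding K_def by (intro image_eqI[of _ _ "snd c p"]) simp_all
  qed
  have "y \<notin> K"
    using r(2) c(1) by (auto simp: K inj_on_eq_iff[OF inj_chart])
  obtain \<epsilon> where "\<epsilon> > 0"
    and low: "\<And>z w. z \<in> cball (snd c x) r \<Longrightarrow> \<epsilon> * norm w \<le> tangent_norm c (chart_inv c z) w"
    using tangent_norm_lower_bound[OF c(1) compact_cball r'] by blast
  then have \<epsilon>: "\<epsilon> > 0" "\<And>p w. p \<in> K \<Longrightarrow> \<epsilon> * norm w \<le> tangent_norm c p w"
    by (auto simp only: K_def)
  \<comment> \<open>A compact subset of a Hausdorff space is closed; this will keep the exit point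
    of a curve in \<open>K\<close>.\<close>
  have "closed K"
    unfolding K_def
    by (intro compact_imp_closed compact_continuous_image compact_cball
        continuous_on_subset[OF continuous_chart_inv[OF c(1)] r'])
  define B where "B = fst c \<inter> snd c -` ball (snd c x) r"
  have "B \<subseteq> K"
    by (auto simp: B_def K)
  have "\<epsilon> * r \<le> l" if l: "joinable x y l" for l
  proof -
    obtain \<gamma> a b where \<gamma>: "arc \<gamma> a b l" "\<gamma> a = x" "\<gamma> b = y"
      using l unfolding joinable_def by blast
    have cont: "continuous_on {a..b} \<gamma>" and "a < b"
      using \<gamma>(1) by (rule arc_continuous, rule arc_less)
    \<comment> \<open>\<open>Inf T\<close> is the first time outside the open ball \<open>B\<close>.
      The curve is then still in \<open>K\<close>, so the chart is usable, and at coordinate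
      distance at least \<open>r\<close> from its start.\<close>
    define T where "T = {a..b} \<inter> \<gamma> -` (- B)"
    have "closed T"
      unfolding T_def using open_chart_ball[OF c(1)] cont
      by (intro continuous_closed_preimage) (auto simp only: B_def closed_Compl closed_atLeastAtMost)
    moreover have "b \<in> T"
      using \<gamma> \<open>a < b\<close> \<open>y \<notin> K\<close> \<open>B \<subseteq> K\<close> by (auto simp: T_def)
    moreover have bdd: "bdd_below T"
      by (intro bdd_belowI[of _ a]) (auto simp: T_def)
    ultimately have s: "Inf T \<in> T"
      by (intro closed_contains_Inf) auto
    define s where "s = Inf T"
    have before: "\<gamma> t \<in> B" if "t \<in> {a..<s}" for t
    proof (rule ccontr)
      assume "\<gamma> t \<notin> B"
      then have "t \<in> T"
        using that s by (auto simp: T_def s_def)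
      then show False
        using cInf_lower[OF _ bdd, of t] that by (simp add: s_def)
    qed
    have "a \<notin> T"
      using \<gamma>(2) c r(1) by (auto simp: T_def B_def)
    then have "a < s" "s \<le> b"
      using s by (auto simp: T_def s_def less_le)
    \<comment> \<open>\<open>before\<close> speaks of times less than \<open>s\<close>; closedness
      of \<open>K\<close> adds the time \<open>s\<close> itself.\<close>
    have "\<gamma> ` closure {a..<s} \<subseteq> K"
      using \<open>closed K\<close> before \<open>B \<subseteq> K\<close> \<open>a < s\<close> \<open>s \<le> b\<close>
      by (intro image_closure_subset continuous_on_subset[OF cont]) auto
    then have sub: "\<gamma> ` {a..s} \<subseteq> K"
      using \<open>a < s\<close> by simp
    \<comment> \<open>Dropping the part after \<open>s\<close> does not increase the length.\<close>
    have "\<exists>l'\<le>l. arc \<gamma> a s l'"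
    proof (cases "s = b")
      case False
      then obtain l1 l2 where "l = l1 + l2" "arc \<gamma> a s l1" "arc \<gamma> s b l2"
        using arc_split[OF \<gamma>(1) \<open>a < s\<close>] \<open>s \<le> b\<close> by auto
      then show ?thesis
        using arc_nonneg[of \<gamma> s b l2] by (intro exI[of _ l1]) simp
    qed (use \<gamma>(1) in auto)
    then obtain l' where l': "l' \<le> l" "arc \<gamma> a s l'"
      by blast
    have "\<gamma> s \<in> K" "\<gamma> s \<notin> B"
      using sub \<open>a < s\<close> s by (auto simp: T_def s_def)
    then have "r \<le> norm (snd c (\<gamma> s) - snd c (\<gamma> a))"
      using \<gamma>(2) K[of "\<gamma> s"] by (auto simp: B_def dist_norm norm_minus_commute)
    then have "\<epsilon> * r \<le> \<epsilon> * norm (snd c (\<gamma> s) - snd c (\<gamma> a))"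
      using \<epsilon>(1) by simp
    also have "\<dots> \<le> l'"
      by (rule arc_chart_length[OF c(1) \<epsilon> _ l'(2) sub]) (auto simp: K)
    finally show ?thesis
      using l' by simp
  qed
  then show ?thesis
    using that[of "\<epsilon> * r"] \<epsilon>(1) r(1) by simp
qed

end

section \<open>The metric space of a compact connected manifold\<close>

locale compact_riemannian = riemannian +
  assumes compact: "compact (UNIV :: 'a set)" and connected: "connected (UNIV :: 'a set)"
begin

text \<open>Being joinable is an equivalence relation that relates every point to a whole
  neighbourhood, so connectedness leaves one class. From here on the infimum defining
  \<open>d\<close> is over a nonempty set.\<close>

lemma joinable_exists: "\<exists>l. joinable x y l"
proof (rule connected_equivalence_relation[OF connected])
  fix p :: 'a
  obtain c where c: "c \<in> A" "p \<in> fst c"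
    using chart_at by blast
  obtain U C where "open U" "p \<in> U" "U \<subseteq> fst c"
    "\<forall>q\<in>U. \<exists>l. joinable p q l \<and> l \<le> C * norm (snd c q - snd c p)"
    using joinable_local[OF c] by (elim exE conjE)
  then show "\<exists>T. openin (top_of_set UNIV) T \<and> p \<in> T \<and> (\<forall>q\<in>T. \<exists>l. joinable p q l)"
    by (intro exI[of _ U]) auto
qed (auto intro: joinable_sym joinable_trans)

lemma riemannian_dist_lessD: "d x y < e \<Longrightarrow> \<exists>l<e. joinable x y l"
  using cInf_lessD[of "{l. joinable x y l}" e] joinable_exists
  unfolding riemannian_dist_joinable by auto

lemma riemannian_dist_greatest: "(\<And>l. joinable x y l \<Longrightarrow> e \<le> l) \<Longrightarrow> e \<le> d x y"
  unfolding riemannian_dist_joinable using joinable_exists by (intro cInf_greatest) auto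

lemma riemannian_dist_nonneg: "0 \<le> d x y"
  by (intro riemannian_dist_greatest joinable_nonneg)

lemma riemannian_dist_self: "d x x = 0"
proof -
  obtain c where c: "c \<in> A" "x \<in> fst c"
    using chart_at by blast
  obtain U C where "open U" "x \<in> U" "U \<subseteq> fst c"
    "\<forall>q\<in>U. \<exists>l. joinable x q l \<and> l \<le> C * norm (snd c q - snd c x)"
    using joinable_local[OF c] by (elim exE conjE)
  from bspec[OF this(4,2)] obtain l where "joinable x x l" "l \<le> 0"
    by auto
  then show ?thesis
    using riemannian_dist_le[of x x l] riemannian_dist_nonneg[of x x] by simp
qed

lemma riemannian_dist_eq_0_iff: "d x y = 0 \<longleftrightarrow> x = y"
proof
  assume "d x y = 0"
  show "x = y"
  proof (rule ccontr)
    assume "x \<noteq> y"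
    then obtain \<epsilon> where "\<epsilon> > 0" "\<And>l. joinable x y l \<Longrightarrow> \<epsilon> \<le> l"
      using joinable_lower_bound by blast
    then show False
      using riemannian_dist_greatest[of x y \<epsilon>] \<open>d x y = 0\<close> by simp
  qed
qed (simp add: riemannian_dist_self)

lemma riemannian_dist_sym: "d x y = d y x"
proof -
  have "{l. joinable x y l} = {l. joinable y x l}"
    using joinable_sym by blast
  then show ?thesis
    by (simp add: riemannian_dist_joinable)
qed

lemma riemannian_dist_triangle: "d x z \<le> d x y + d y z"
proof (rule field_le_epsilon)
  fix e :: real assume "0 < e"
  obtain l where l: "l < d x y + e / 2" "joinable x y l"
    using riemannian_dist_lessD[of x y "d x y + e / 2"] \<open>0 < e\<close> by auto
  obtain l' where l': "l' < d y z + e / 2" "joinable y z l'"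
    using riemannian_dist_lessD[of y z "d y z + e / 2"] \<open>0 < e\<close> by auto
  have "d x z \<le> l + l'"
    by (intro riemannian_dist_le joinable_trans[OF l(2) l'(2)])
  then show "d x z \<le> d x y + d y z + e"
    using l l' by linarith
qed

lemma riemannian_dist_isometry_le:
  assumes "riemannian_isometry A g f"
  shows "d (f x) (f y) \<le> d x y"
  by (rule riemannian_dist_greatest, rule riemannian_dist_le) (rule joinable_isometry[OF _ assms])

text \<open>The linear bound of \<open>joinable_local\<close> compares \<open>d\<close> with the
  given topology; the triangle inequality then makes \<open>d\<close> jointly continuous.\<close>

lemma riemannian_dist_tendsto_0: "((\<lambda>p. d q p) \<longlongrightarrow> 0) (nhds q)"
proof -
  obtain c where c: "c \<in> A" "q \<in> fst c"
    using chart_at by blast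
  obtain U C where U: "open U" "q \<in> U" "U \<subseteq> fst c"
    and C: "\<forall>p\<in>U. \<exists>l. joinable q p l \<and> l \<le> C * norm (snd c p - snd c q)"
    using joinable_local[OF c] by (elim exE conjE)
  have "isCont (snd c) q"
    using continuous_chart[OF c(1)] c open_chart[OF c(1)] by (simp add: continuous_on_eq_continuous_at)
  then have "(snd c \<longlongrightarrow> snd c q) (nhds q)"
    by (simp add: isCont_def tendsto_at_iff_tendsto_nhds)
  then have "((\<lambda>p. C * norm (snd c p - snd c q)) \<longlongrightarrow> C * norm (snd c q - snd c q)) (nhds q)"
    by (intro tendsto_intros)
  then have lim: "((\<lambda>p. C * norm (snd c p - snd c q)) \<longlongrightarrow> 0) (nhds q)"
    by simp
  have ev: "\<forall>\<^sub>F p in nhds q. d q p \<le> C * norm (snd c p - snd c q)"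
    using eventually_nhds_in_open[OF U(1,2)]
  proof eventually_elim
    case (elim p)
    then show ?case
      using bspec[OF C, of p] riemannian_dist_le[of q p] by (meson order_trans)
  qed
  show ?thesis
    by (rule tendsto_sandwich[OF _ ev tendsto_const lim]) (simp add: riemannian_dist_nonneg)
qed

lemma continuous_on_riemannian_dist: "continuous_on UNIV (\<lambda>z. d (fst z) (snd z))"
  unfolding continuous_on_def
proof
  fix z :: "'a \<times> 'a"
  have "((\<lambda>w. d (fst z) (fst w) + d (snd z) (snd w)) \<longlongrightarrow> 0 + 0) (at z)"
    by (intro tendsto_add filterlim_compose[OF riemannian_dist_tendsto_0] tendsto_intros
        filterlim_mono[OF _ order_refl at_le])
  then have lim: "((\<lambda>w. d (fst z) (fst w) + d (snd z) (snd w)) \<longlongrightarrow> 0) (at z)"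
    by simp
  have "\<bar>d (fst w) (snd w) - d (fst z) (snd z)\<bar> \<le> d (fst z) (fst w) + d (snd z) (snd w)" for w
    using riemannian_dist_triangle[of "fst w" "snd w" "fst z"]
      riemannian_dist_triangle[of "fst z" "snd w" "snd z"]
      riemannian_dist_triangle[of "fst z" "snd z" "fst w"]
      riemannian_dist_triangle[of "fst w" "snd z" "snd w"]
      riemannian_dist_sym[of "fst w" "fst z"] riemannian_dist_sym[of "snd w" "snd z"]
    by linarith
  then have "((\<lambda>w. d (fst w) (snd w) - d (fst z) (snd z)) \<longlongrightarrow> 0) (at z)"
    by (intro Lim_null_comparison[OF _ lim]) auto
  then show "((\<lambda>w. d (fst w) (snd w)) \<longlongrightarrow> d (fst z) (snd z)) (at z within UNIV)"
    by (simp add: LIM_zero_iff)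
qed

lemma continuous_on_riemannian_dist_compose [continuous_intros]:
  assumes "continuous_on S f" "continuous_on S h"
  shows "continuous_on S (\<lambda>t. d (f t) (h t))"
  using continuous_on_compose2[OF continuous_on_riemannian_dist continuous_on_Pair[OF assms]] by simp

lemma riemannian_dist_between:
  assumes "0 \<le> r" "r \<le> d x y"
  shows "\<exists>m. d x m = r \<and> d m y = d x y - r"
proof -
  \<comment> \<open>A curve of length \<open>l < d x y + e\<close> meets the sphere of radius
    \<open>r\<close> around \<open>x\<close>. Its first part has length at least \<open>r\<close>,
    so at most \<open>l - r\<close> remains for the second.\<close>
  have approx: "\<exists>m. d x m = r \<and> d m y \<le> d x y - r + e" if "0 < e" for e
  proof -
    obtain l where l: "l < d x y + e" "joinable x y l"
      using riemannian_dist_lessD[of x y "d x y + e"] \<open>0 < e\<close> by auto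
    then obtain \<gamma> where \<gamma>: "arc \<gamma> 0 1 l" "\<gamma> 0 = x" "\<gamma> 1 = y"
      using joinable_unit by blast
    have "continuous_on {0..1} (\<lambda>t. d x (\<gamma> t))"
      using \<gamma>(1) by (intro continuous_intros arc_continuous)
    then obtain t where t: "0 \<le> t" "t \<le> 1" "d x (\<gamma> t) = r"
      using IVT'[of "\<lambda>t. d x (\<gamma> t)" 0 r 1] assms \<gamma> by (auto simp: riemannian_dist_self)
    \<comment> \<open>\<open>arc_split\<close> needs an interior time; at the end times the point is
      \<open>x\<close> or \<open>y\<close> itself.\<close>
    consider "t = 0" | "t = 1" | "0 < t" "t < 1"
      using t by linarith
    then show ?thesis
    proof cases
      case 3
      then obtain l1 l2 where "l = l1 + l2" "arc \<gamma> 0 t l1" "arc \<gamma> t 1 l2"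
        using arc_split[OF \<gamma>(1)] by blast
      moreover from this have "d x (\<gamma> t) \<le> l1" "d (\<gamma> t) y \<le> l2"
        using \<gamma> by (intro riemannian_dist_le arc_joinable[of \<gamma>]; simp)+
      ultimately show ?thesis
        using t l by (intro exI[of _ "\<gamma> t"]) auto
    qed (use t \<gamma> that in \<open>auto simp: riemannian_dist_self intro!: exI[of _ "\<gamma> t"]\<close>)
  qed
  have "\<exists>m. d x m = r \<and> d m y \<le> d x y - r + inverse (real (Suc n))" for n
    by (rule approx) simp
  then obtain m where m: "\<And>n. d x (m n) = r" "\<And>n. d (m n) y \<le> d x y - r + inverse (real (Suc n))"
    by metis
  obtain p s where s: "strict_mono (s :: nat \<Rightarrow> nat)" and p: "(m \<circ> s) \<longlonglongrightarrow> p"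
    using compact_imp_seq_compact[OF compact, unfolded seq_compact_def, rule_format, of m] by auto
  have lim: "(\<lambda>n. d x ((m \<circ> s) n)) \<longlonglongrightarrow> d x p" "(\<lambda>n. d ((m \<circ> s) n) y) \<longlonglongrightarrow> d p y"
    by (intro continuous_on_tendsto_compose[OF _ p, where s = UNIV] continuous_intros; simp)+
  have "d x p = r"
    using lim(1) m(1) by (simp add: comp_def LIMSEQ_const_iff)
  moreover have "d p y \<le> d x y - r"
  proof (rule LIMSEQ_le[OF lim(2)])
    have "(\<lambda>n. d x y - r + inverse (real (Suc n))) \<longlonglongrightarrow> d x y - r + 0"
      by (intro tendsto_intros LIMSEQ_inverse_real_of_nat)
    from LIMSEQ_subseq_LIMSEQ[OF this s]
    show "((\<lambda>n. d x y - r + inverse (real (Suc n))) \<circ> s) \<longlonglongrightarrow> d x y - r"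
      by simp
    show "\<exists>N. \<forall>n\<ge>N. d ((m \<circ> s) n) y \<le> ((\<lambda>n. d x y - r + inverse (real (Suc n))) \<circ> s) n"
      using m(2) by simp
  qed
  ultimately show ?thesis
    using riemannian_dist_triangle[of x y p] by (intro exI[of _ p]) simp
qed

end

section \<open>Change of variables\<close>

text \<open>The library proves the change of variables formula for vectors over a well-ordered index type
  only; \<open>'n ranked\<close> is a well-ordered copy of the finite type \<open>'n\<close>.\<close>

typedef 'n ranked = "UNIV :: 'n set" morphisms of_ranked to_ranked
  by blast

lemma to_ranked_of_ranked [simp]: "to_ranked (of_ranked i) = i"
  by (rule of_ranked_inverse)

lemma of_ranked_to_ranked [simp]: "of_ranked (to_ranked i) = i"
  by (rule to_ranked_inverse) simp

lemma of_ranked_eq_iff [simp]: "of_ranked i = of_ranked j \<longleftrightarrow> i = j"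
  by (rule of_ranked_inject)

lemma to_ranked_eq_iff [simp]: "to_ranked i = to_ranked j \<longleftrightarrow> i = j"
  by (metis of_ranked_to_ranked)

lemma bij_of_ranked: "bij of_ranked"
  by (rule bij_betw_byWitness[of _ to_ranked]) auto

lemma bij_to_ranked: "bij to_ranked"
  by (rule bij_betw_byWitness[of _ of_ranked]) auto

instance ranked :: (finite) finite
proof
  have "(UNIV :: 'a ranked set) = to_ranked ` UNIV"
    by (rule bij_is_surj[OF bij_to_ranked, symmetric])
  then show "finite (UNIV :: 'a ranked set)"
    by (metis finite finite_imageI)
qed

instantiation ranked :: (finite) wellorder
begin

text \<open>Any injection into the naturals will do: the order has no geometric meaning, as neither
  \<open>lborel\<close> nor determinants depend on it.\<close>

definition rank :: "'a ranked \<Rightarrow> nat" where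
  "rank = (SOME r. inj r)"

definition less_eq_ranked :: "'a ranked \<Rightarrow> 'a ranked \<Rightarrow> bool" where
  "less_eq_ranked i j \<longleftrightarrow> rank i \<le> rank j"

definition less_ranked :: "'a ranked \<Rightarrow> 'a ranked \<Rightarrow> bool" where
  "less_ranked i j \<longleftrightarrow> rank i < rank j"

instance
proof
  have inj: "inj (rank :: 'a ranked \<Rightarrow> nat)"
    unfolding rank_def using finite_imp_inj_to_nat_seg[OF finite[of "UNIV :: 'a ranked set"]]
    by (intro someI_ex[of inj]) blast
  fix i j k :: "'a ranked"
  show "i < j \<longleftrightarrow> i \<le> j \<and> \<not> j \<le> i" "i \<le> i" "i \<le> j \<Longrightarrow> j \<le> k \<Longrightarrow> i \<le> k" "i \<le> j \<or> j \<le> i"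
    by (auto simp: less_eq_ranked_def less_ranked_def)
  show "i \<le> j \<Longrightarrow> j \<le> i \<Longrightarrow> i = j"
    using inj by (auto simp: less_eq_ranked_def inj_def)
  show "P i" if "\<And>i. (\<And>j. j < i \<Longrightarrow> P j) \<Longrightarrow> P i" for P and i :: "'a ranked"
    using that unfolding less_ranked_def by (induction i rule: measure_induct[of rank]) blast
qed

end

section \<open>Relabelling of coordinates\<close>

definition vec_ranked :: "'a ^ 'n \<Rightarrow> 'a ^ ('n ranked)" where
  "vec_ranked x = (\<chi> i. x $ of_ranked i)"

definition vec_unranked :: "'a ^ ('n ranked) \<Rightarrow> 'a ^ 'n" where
  "vec_unranked x = (\<chi> i. x $ to_ranked i)"

lemma vec_ranked_nth [simp]: "vec_ranked x $ i = x $ of_ranked i"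
  and vec_unranked_nth [simp]: "vec_unranked y $ j = y $ to_ranked j"
  by (simp_all add: vec_ranked_def vec_unranked_def)

lemma vec_ranked_unranked [simp]: "vec_ranked (vec_unranked x) = x"
  and vec_unranked_ranked [simp]: "vec_unranked (vec_ranked y) = y"
  by (simp_all add: vec_eq_iff)

lemma linear_vec_ranked: "linear (vec_ranked :: real ^ 'n::finite \<Rightarrow> _)"
  and linear_vec_unranked: "linear (vec_unranked :: real ^ ('n::finite ranked) \<Rightarrow> _)"
  by (rule linearI; simp add: vec_eq_iff)+

lemma vec_ranked_has_derivative:
  "((vec_ranked :: real ^ 'n::finite \<Rightarrow> _) has_derivative vec_ranked) F"
  using linear_vec_ranked by (intro bounded_linear_imp_has_derivative) (simp add: linear_conv_bounded_linear)

lemma vec_unranked_has_derivative: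
  "((vec_unranked :: real ^ ('n::finite ranked) \<Rightarrow> _) has_derivative vec_unranked) F"
  using linear_vec_unranked by (intro bounded_linear_imp_has_derivative) (simp add: linear_conv_bounded_linear)

lemma vec_ranked_measurable [measurable]: "(vec_ranked :: real ^ 'n::finite \<Rightarrow> _) \<in> borel_measurable borel"
  using linear_vec_ranked
  by (intro borel_measurable_continuous_onI linear_continuous_on) (simp add: linear_conv_bounded_linear)

lemma vec_unranked_measurable [measurable]:
  "(vec_unranked :: real ^ ('n::finite ranked) \<Rightarrow> _) \<in> borel_measurable borel"
  using linear_vec_unranked
  by (intro borel_measurable_continuous_onI linear_continuous_on) (simp add: linear_conv_bounded_linear)

lemma vec_ranked_axis: "vec_ranked (axis i x) = axis (to_ranked i) x"
  and vec_unranked_axis: "vec_unranked (axis j x) = axis (of_ranked j) x"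
  by (auto simp: vec_eq_iff axis_def)

text \<open>Relabelling takes boxes to boxes with the same side lengths, and Lebesgue measure is
  determined by its values on boxes.\<close>

lemma distr_vec_ranked: "distr lborel borel vec_ranked = (lborel :: (real ^ ('n::finite ranked)) measure)"
proof (rule lborel_eqI[symmetric])
  fix l u :: "real ^ ('n ranked)"
  assume le: "\<And>b. b \<in> Basis \<Longrightarrow> l \<bullet> b \<le> u \<bullet> b"
  have "vec_ranked -` box l u = box (vec_unranked l) (vec_unranked u)"
    unfolding interval_cart by (auto simp: set_eq_iff) (metis of_ranked_to_ranked to_ranked_of_ranked)+
  then have "emeasure (distr lborel borel vec_ranked) (box l u) =
      emeasure lborel (box (vec_unranked l) (vec_unranked u))"
    by (subst emeasure_distr) auto
  also have "\<dots> = (\<Prod>b\<in>Basis. (vec_unranked u - vec_unranked l) \<bullet> b)"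
  proof (intro emeasure_lborel_box)
    have "l $ i \<le> u $ i" for i
      using le[of "axis i 1"] by (simp add: inner_axis axis_in_Basis_iff)
    then show "vec_unranked l \<bullet> b \<le> vec_unranked u \<bullet> b" if "b \<in> Basis" for b
      using that by (auto simp: Basis_vec_def inner_axis)
  qed
  also have "\<dots> = (\<Prod>b\<in>Basis. (u - l) \<bullet> b)"
    by (rule arg_cong[of _ _ ennreal], rule prod.reindex_bij_witness[of _ vec_unranked vec_ranked])
      (auto simp: Basis_vec_def inner_axis vec_ranked_axis vec_unranked_axis)
  finally show "emeasure (distr lborel borel vec_ranked) (box l u) = (\<Prod>b\<in>Basis. (u - l) \<bullet> b)" .
qed simp

text \<open>Induction over transpositions: the conjugate of a transposition by the bijection
  \<open>to_ranked\<close> is again a transposition.\<close>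

lemma sign_conj_ranked:
  fixes p :: "'n::finite \<Rightarrow> 'n"
  assumes "p permutes UNIV"
  shows "sign (to_ranked \<circ> p \<circ> of_ranked) = sign p"
  using assms finite
proof (induction rule: permutes_induct)
  case id
  have "to_ranked \<circ> id \<circ> of_ranked = (id :: 'n ranked \<Rightarrow> _)"
    by auto
  then show ?case
    by simp
next
  case (swap a b p)
  have eq: "to_ranked \<circ> (Transposition.transpose a b \<circ> p) \<circ> of_ranked =
      Transposition.transpose (to_ranked a) (to_ranked b) \<circ> (to_ranked \<circ> p \<circ> of_ranked)"
    by (auto simp: fun_eq_iff Transposition.transpose_def)
  have "bij (to_ranked \<circ> p \<circ> of_ranked)"
    using swap by (intro bij_comp bij_of_ranked bij_to_ranked permutes_bij)
  then have "permutation (to_ranked \<circ> p \<circ> of_ranked)" "permutation p"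
    using permutes_bij[of p UNIV] swap by (auto simp: permutation)
  moreover have "to_ranked a \<noteq> to_ranked b"
    using swap by simp
  ultimately show ?case
    unfolding eq using swap by (simp only: sign_compose sign_swap_id permutation_swap_id if_False)
qed

text \<open>The Leibniz sum is reindexed by conjugating permutations, which preserves signs.\<close>

lemma det_ranked:
  fixes M :: "real ^ 'n::finite ^ 'n"
  shows "det (\<chi> i j. M $ of_ranked i $ of_ranked j) = det M"
  unfolding det_def
proof (rule sum.reindex_bij_witness[of _ "\<lambda>p. to_ranked \<circ> p \<circ> of_ranked" "\<lambda>q. of_ranked \<circ> q \<circ> to_ranked"])
  fix p :: "'n \<Rightarrow> 'n" assume "p \<in> {p. p permutes UNIV}"
  then have p: "p permutes UNIV"
    by simp
  show "to_ranked \<circ> p \<circ> of_ranked \<in> {p. p permutes UNIV}"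
    using p by (auto intro!: bij_imp_permutes bij_comp bij_of_ranked bij_to_ranked permutes_bij)
  show "of_ranked \<circ> (to_ranked \<circ> p \<circ> of_ranked) \<circ> to_ranked = p"
    by auto
next
  fix q :: "'n ranked \<Rightarrow> 'n ranked" assume "q \<in> {q. q permutes UNIV}"
  then have q: "q permutes UNIV"
    by simp
  show p: "of_ranked \<circ> q \<circ> to_ranked \<in> {p. p permutes UNIV}"
    using q by (auto intro!: bij_imp_permutes bij_comp bij_of_ranked bij_to_ranked permutes_bij)
  show conj_back: "to_ranked \<circ> (of_ranked \<circ> q \<circ> to_ranked) \<circ> of_ranked = q"
    by auto
  have "sign q = sign (of_ranked \<circ> q \<circ> to_ranked)"
    using sign_conj_ranked[of "of_ranked \<circ> q \<circ> to_ranked"] p conj_back by simp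
  moreover have "(\<Prod>i\<in>UNIV. M $ i $ (of_ranked \<circ> q \<circ> to_ranked) i) =
      (\<Prod>i\<in>UNIV. (\<chi> i j. M $ of_ranked i $ of_ranked j) $ i $ q i)"
    by (rule prod.reindex_bij_witness[of _ of_ranked to_ranked]) auto
  ultimately show "of_int (sign (of_ranked \<circ> q \<circ> to_ranked)) *
      (\<Prod>i\<in>UNIV. M $ i $ (of_ranked \<circ> q \<circ> to_ranked) i) =
      of_int (sign q) * (\<Prod>i\<in>UNIV. (\<chi> i j. M $ of_ranked i $ of_ranked j) $ i $ q i)"
    by simp
qed

lemma det_matrix_ranked:
  fixes L :: "real ^ 'n::finite \<Rightarrow> real ^ 'n"
  shows "det (matrix (vec_ranked \<circ> L \<circ> vec_unranked)) = det (matrix L)"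
proof -
  have "matrix (vec_ranked \<circ> L \<circ> vec_unranked) = (\<chi> i j. matrix L $ of_ranked i $ of_ranked j)"
    by (simp add: matrix_def vec_eq_iff vec_unranked_axis)
  then show ?thesis
    by (simp add: det_ranked)
qed

text \<open>The bridge between Lebesgue and gauge integrals. As an equivalence for each finite value
  \<open>r\<close> it presupposes no finiteness of the integral.\<close>

lemma set_nn_integral_eq_iff_has_integral:
  fixes G :: "'a::euclidean_space \<Rightarrow> real"
  assumes "\<And>x. x \<in> S \<Longrightarrow> 0 \<le> G x" "(\<lambda>x. indicator S x * G x) \<in> borel_measurable borel" "0 \<le> r"
  shows "(\<integral>\<^sup>+x\<in>S. ennreal (G x) \<partial>lborel) = ennreal r \<longleftrightarrow> (G has_integral r) S"
proof -
  let ?f = "\<lambda>x. indicator S x * G x"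
  have meas: "?f \<in> borel_measurable lebesgue"
    using assms(2) by (intro measurable_completion) simp
  have "(G has_integral r) S \<longleftrightarrow> ((\<lambda>x. if x \<in> S then G x else 0) has_integral r) UNIV"
    by (rule has_integral_restrict_UNIV[symmetric])
  also have "(\<lambda>x. if x \<in> S then G x else 0) = ?f"
    by (auto simp: indicator_def)
  also have "(?f has_integral r) UNIV \<longleftrightarrow> (\<integral>\<^sup>+x. ennreal (?f x) \<partial>lborel) = ennreal r"
    using assms(1) meas \<open>0 \<le> r\<close>
    by (subst has_integral_iff_nn_integral_lebesgue) (auto simp: indicator_def nn_integral_completion)
  also have "(\<integral>\<^sup>+x. ennreal (?f x) \<partial>lborel) = (\<integral>\<^sup>+x\<in>S. ennreal (G x) \<partial>lborel)"
    by (intro nn_integral_cong) (auto simp: indicator_def)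
  finally show ?thesis
    by simp
qed

lemma nn_integral_change_of_variables_wellorder:
  fixes f h :: "real ^ 'n::{finite,wellorder} \<Rightarrow> real ^ 'n::_" and F :: "real ^ 'n::_ \<Rightarrow> real"
  assumes der_f: "\<And>x. x \<in> S \<Longrightarrow> (f has_derivative f' x) (at x)"
    and der_h: "\<And>y. y \<in> T \<Longrightarrow> (h has_derivative h' y) (at y)"
    and F: "\<And>y. y \<in> T \<Longrightarrow> 0 \<le> F y"
    and hf: "\<And>x. x \<in> S \<Longrightarrow> f x \<in> T \<and> h (f x) = x"
    and fh: "\<And>y. y \<in> T \<Longrightarrow> h y \<in> S \<and> f (h y) = y"
    and id: "\<And>y. y \<in> T \<Longrightarrow> h' y \<circ> f' (h y) = id"
    and meas: "(\<lambda>y. indicator T y * F y) \<in> borel_measurable borel"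
      "(\<lambda>x. indicator S x * (\<bar>det (matrix (f' x))\<bar> * F (f x))) \<in> borel_measurable borel"
  shows "(\<integral>\<^sup>+y\<in>T. ennreal (F y) \<partial>lborel) =
    (\<integral>\<^sup>+x\<in>S. ennreal (\<bar>det (matrix (f' x))\<bar> * F (f x)) \<partial>lborel)" (is "?I = ?J")
proof -
  have iff: "?I = ennreal r \<longleftrightarrow> ?J = ennreal r" if "0 \<le> r" for r
  proof -
    have "?I = ennreal r \<longleftrightarrow> (F has_integral r) T"
      by (rule set_nn_integral_eq_iff_has_integral[OF F meas(1) that])
    also have "\<dots> \<longleftrightarrow> ((\<lambda>x. \<bar>det (matrix (f' x))\<bar> * F (f x)) has_integral r) S"
      by (rule cov_invertible_nonneg_eq[OF has_derivative_at_withinI[OF der_f]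
          has_derivative_at_withinI[OF der_h] F hf fh id, symmetric])
    also have "\<dots> \<longleftrightarrow> ?J = ennreal r"
      using hf F by (intro set_nn_integral_eq_iff_has_integral[symmetric] meas(2) that) auto
    finally show ?thesis .
  qed
  \<comment> \<open>By \<open>iff\<close> the two sides take the same finite values; so if one is
    infinite, the other has to be infinite too.\<close>
  show ?thesis
  proof (cases ?I)
    case (real r)
    then show ?thesis
      using iff[of r] by simp
  next
    case I: top
    show ?thesis
    proof (cases ?J)
      case (real r)
      then show ?thesis
        using iff[of r] by simp
    qed (use I in simp)
  qed
qed

lemma nn_integral_vec_ranked:
  fixes G :: "real ^ 'n::finite \<Rightarrow> real"
  assumes "(\<lambda>x. indicator S x * G x) \<in> borel_measurable borel"
  shows "(\<integral>\<^sup>+x\<in>vec_ranked ` S. ennreal (G (vec_unranked x)) \<partial>lborel) = (\<integral>\<^sup>+x\<in>S. ennreal (G x) \<partial>lborel)"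
    and "(\<lambda>x. indicator (vec_ranked ` S) x * G (vec_unranked x)) \<in> borel_measurable borel"
proof -
  have mem: "x \<in> vec_ranked ` S \<longleftrightarrow> vec_unranked x \<in> S" for x
    by (metis image_iff vec_ranked_unranked vec_unranked_ranked)
  have eq: "(\<lambda>x. indicator (vec_ranked ` S) x * G (vec_unranked x)) = (\<lambda>x. indicator S x * G x) \<circ> vec_unranked"
    by (auto simp: fun_eq_iff indicator_def mem)
  show meas: "(\<lambda>x. indicator (vec_ranked ` S) x * G (vec_unranked x)) \<in> borel_measurable borel"
    unfolding eq by (rule measurable_comp[OF vec_unranked_measurable assms])
  have "(\<integral>\<^sup>+x\<in>vec_ranked ` S. ennreal (G (vec_unranked x)) \<partial>lborel) =
      (\<integral>\<^sup>+x. ennreal (indicator (vec_ranked ` S) x * G (vec_unranked x)) \<partial>distr lborel borel vec_ranked)"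
    unfolding distr_vec_ranked by (intro nn_integral_cong) (auto simp: indicator_def)
  also have "\<dots> = (\<integral>\<^sup>+x. ennreal (indicator (vec_ranked ` S) (vec_ranked x) * G (vec_unranked (vec_ranked x))) \<partial>lborel)"
    using meas by (intro nn_integral_distr) auto
  also have "\<dots> = (\<integral>\<^sup>+x\<in>S. ennreal (G x) \<partial>lborel)"
    by (intro nn_integral_cong) (auto simp: indicator_def mem)
  finally show "(\<integral>\<^sup>+x\<in>vec_ranked ` S. ennreal (G (vec_unranked x)) \<partial>lborel) = (\<integral>\<^sup>+x\<in>S. ennreal (G x) \<partial>lborel)" .
qed

text \<open>The maps are conjugated by the relabelling, which changes neither Lebesgue measure nor
  the determinant of the derivative.\<close>

lemma nn_integral_change_of_variables:
  fixes f h :: "real ^ 'n::finite \<Rightarrow> real ^ 'n::_" and F :: "real ^ 'n::_ \<Rightarrow> real"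
  assumes der_f: "\<And>x. x \<in> S \<Longrightarrow> (f has_derivative f' x) (at x)"
    and der_h: "\<And>y. y \<in> T \<Longrightarrow> (h has_derivative h' y) (at y)"
    and F: "\<And>y. y \<in> T \<Longrightarrow> 0 \<le> F y"
    and hf: "\<And>x. x \<in> S \<Longrightarrow> f x \<in> T \<and> h (f x) = x"
    and fh: "\<And>y. y \<in> T \<Longrightarrow> h y \<in> S \<and> f (h y) = y"
    and id: "\<And>y. y \<in> T \<Longrightarrow> h' y \<circ> f' (h y) = id"
    and meas: "(\<lambda>y. indicator T y * F y) \<in> borel_measurable borel"
      "(\<lambda>x. indicator S x * (\<bar>det (matrix (f' x))\<bar> * F (f x))) \<in> borel_measurable borel"
  shows "(\<integral>\<^sup>+y\<in>T. ennreal (F y) \<partial>lborel) =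
    (\<integral>\<^sup>+x\<in>S. ennreal (\<bar>det (matrix (f' x))\<bar> * F (f x)) \<partial>lborel)"
proof -
  let ?R = "vec_ranked :: real ^ 'n \<Rightarrow> _" and ?Q = "vec_unranked :: _ \<Rightarrow> real ^ 'n"
  define f2 where "f2 = ?R \<circ> f \<circ> ?Q"
  define h2 where "h2 = ?R \<circ> h \<circ> ?Q"
  define f2' where "f2' x = ?R \<circ> f' (?Q x) \<circ> ?Q" for x
  define h2' where "h2' y = ?R \<circ> h' (?Q y) \<circ> ?Q" for y
  have mem: "x \<in> ?R ` S \<longleftrightarrow> ?Q x \<in> S" for x S
    by (metis image_iff vec_ranked_unranked vec_unranked_ranked)
  have det: "det (matrix (f2' x)) = det (matrix (f' (?Q x)))" for x
    unfolding f2'_def by (rule det_matrix_ranked)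
  note T = nn_integral_vec_ranked[OF meas(1)] and S = nn_integral_vec_ranked[OF meas(2)]
  have "(\<integral>\<^sup>+y\<in>?R ` T. ennreal (F (?Q y)) \<partial>lborel) =
      (\<integral>\<^sup>+x\<in>?R ` S. ennreal (\<bar>det (matrix (f2' x))\<bar> * F (?Q (f2 x))) \<partial>lborel)"
  proof (rule nn_integral_change_of_variables_wellorder[where h = h2 and h' = h2'])
    show "(f2 has_derivative f2' x) (at x)" if "x \<in> ?R ` S" for x
      unfolding f2_def f2'_def using that mem
      by (intro diff_chain_at vec_ranked_has_derivative vec_unranked_has_derivative der_f) auto
    show "(h2 has_derivative h2' x) (at x)" if "x \<in> ?R ` T" for x
      unfolding h2_def h2'_def using that mem
      by (intro diff_chain_at vec_ranked_has_derivative vec_unranked_has_derivative der_h) auto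
    show "h2' y \<circ> f2' (h2 y) = id" if "y \<in> ?R ` T" for y
      using fun_cong[OF id[of "?Q y"]] that unfolding mem by (auto simp: fun_eq_iff h2'_def f2'_def h2_def)
    show "(\<lambda>x. indicator (?R ` S) x * (\<bar>det (matrix (f2' x))\<bar> * F (?Q (f2 x)))) \<in> borel_measurable borel"
      using S(2) by (simp add: det f2_def)
  qed (use F hf fh T(2) in \<open>auto simp: f2_def h2_def\<close>)
  then show ?thesis
    using T(1) S(1) by (simp add: det f2_def)
qed

section \<open>The Riemannian volume\<close>

lemma continuous_on_det:
  fixes M :: "'a::topological_space \<Rightarrow> real ^ 'n ^ 'n"
  assumes "continuous_on S M"
  shows "continuous_on S (\<lambda>x. det (M x))"
  unfolding det_def using assms by (intro continuous_intros)

text \<open>The determinant cannot vanish on the segment from \<open>G\<close> to the identity.\<close>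

lemma det_pos_of_positive_definite:
  fixes G :: "real ^ 'n ^ 'n"
  assumes "\<And>v. v \<noteq> 0 \<Longrightarrow> 0 < v \<bullet> (G *v v)"
  shows "0 < det G"
proof (rule ccontr)
  assume "\<not> 0 < det G"
  define M where "M t = (1 - t) *\<^sub>R mat 1 + t *\<^sub>R G" for t :: real
  have "continuous_on {0..1} (\<lambda>t. det (M t))"
    unfolding M_def by (intro continuous_on_det continuous_intros)
  moreover have "det (M 0) = 1" "det (M 1) = det G"
    by (simp_all add: M_def)
  ultimately obtain t where t: "0 \<le> t" "t \<le> 1" "det (M t) = 0"
    using IVT2'[of "\<lambda>t. det (M t)" 1 0 0] \<open>\<not> 0 < det G\<close> by auto
  \<comment> \<open>The quadratic form of \<open>M t\<close> would vanish at a kernel vector,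
    although it is a convex combination of two positive definite forms.\<close>
  have "\<exists>v. v \<noteq> 0 \<and> M t *v v = 0"
    using t(3) invertible_det_nz[of "M t"]
    unfolding invertible_left_inverse matrix_left_invertible_ker by blast
  then obtain v where v: "v \<noteq> 0" "M t *v v = 0"
    by blast
  have "v \<bullet> (M t *v v) = (1 - t) * (v \<bullet> v) + t * (v \<bullet> (G *v v))"
    by (simp add: M_def matrix_vector_mult_add_rdistrib scaleR_matrix_vector_assoc[symmetric] inner_add_right)
  moreover have "0 < (1 - t) * (v \<bullet> v) + t * (v \<bullet> (G *v v))"
    using t assms[OF v(1)] v(1)
    by (cases "t = 0") (auto intro!: add_nonneg_pos)
  ultimately show False
    using v(2) by simp
qed

context riemannian
begin

definition volume_density :: "('a, 'n) chart \<Rightarrow> real ^ 'n \<Rightarrow> real" where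
  "volume_density c x = sqrt (det (g c (chart_inv c x)))"

definition chart_volume :: "('a, 'n) chart \<Rightarrow> 'a set \<Rightarrow> ennreal" where
  "chart_volume c B = (\<integral>\<^sup>+x\<in>snd c ` B. ennreal (volume_density c x) \<partial>lborel)"

lemma volume_density_pos:
  assumes "c \<in> A" "x \<in> snd c ` fst c"
  shows "0 < volume_density c x"
  unfolding volume_density_def
  using det_pos_of_positive_definite[OF metric_pos[OF assms(1) chart_inv_in[OF assms(2)]]] by simp

lemma continuous_on_volume_density: "c \<in> A \<Longrightarrow> continuous_on (snd c ` fst c) (volume_density c)"
  unfolding volume_density_def
  by (intro continuous_intros continuous_on_det continuous_on_compose2[OF continuous_on_metric]
      continuous_chart_inv) auto

text \<open>The image under a chart is the preimage under its continuous inverse.\<close>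

lemma chart_image_borel:
  assumes c: "c \<in> A" and B: "B \<in> sets borel" "B \<subseteq> fst c"
  shows "snd c ` B \<in> sets borel"
proof -
  have "chart_inv c -` B \<inter> snd c ` fst c \<in> sets (restrict_space borel (snd c ` fst c))"
    using measurable_sets[OF borel_measurable_continuous_on_restrict[OF continuous_chart_inv[OF c]] B(1)]
    by (simp add: space_restrict_space)
  moreover have "chart_inv c -` B \<inter> snd c ` fst c = snd c ` B"
    using B(2) c by force
  ultimately show ?thesis
    using open_chart_image[OF c] by (subst (asm) sets_restrict_space_iff) auto
qed

lemma volume_density_measurable:
  assumes "c \<in> A" "S \<in> sets borel" "S \<subseteq> snd c ` fst c"
  shows "(\<lambda>x. indicator S x * volume_density c x) \<in> borel_measurable borel"
  using borel_measurable_continuous_on_indicator[OF assms(2)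
      continuous_on_subset[OF continuous_on_volume_density[OF assms(1)] assms(3)]]
  by simp

text \<open>Presents the chart volume as an honest measure of the coordinate image, so that
  countable additivity is inherited. The cutoff outside the image of the chart makes the density
  measurable.\<close>

lemma chart_volume_density:
  assumes c: "c \<in> A" and B: "B \<in> sets borel" "B \<subseteq> fst c"
  shows "chart_volume c B =
    emeasure (density lborel (\<lambda>x. ennreal (indicator (snd c ` fst c) x * volume_density c x))) (snd c ` B)"
proof -
  have "(\<lambda>x. ennreal (indicator (snd c ` fst c) x * volume_density c x)) \<in> borel_measurable lborel"
    using volume_density_measurable[OF c _ order_refl] open_chart_image[OF c] by simp
  moreover have "snd c ` B \<in> sets lborel"
    using chart_image_borel[OF c B] by simp
  ultimately have "emeasure (density lborel (\<lambda>x. ennreal (indicator (snd c ` fst c) x * volume_density c x))) (snd c ` B) =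
      (\<integral>\<^sup>+x. ennreal (indicator (snd c ` fst c) x * volume_density c x) * indicator (snd c ` B) x \<partial>lborel)"
    by (rule emeasure_density)
  also have "\<dots> = chart_volume c B"
    unfolding chart_volume_def using B(2) by (intro nn_integral_cong) (auto simp: indicator_def)
  finally show ?thesis
    by simp
qed

lemma chart_volume_suminf:
  fixes B :: "nat \<Rightarrow> 'a set"
  assumes c: "c \<in> A" and B: "\<And>i. B i \<in> sets borel" "\<And>i. B i \<subseteq> fst c" and disj: "disjoint_family B"
  shows "(\<Sum>i. chart_volume c (B i)) = chart_volume c (\<Union>i. B i)"
proof -
  let ?N = "density lborel (\<lambda>x. ennreal (indicator (snd c ` fst c) x * volume_density c x))"
  have "disjoint_family (\<lambda>i. snd c ` B i)"
    unfolding disjoint_family_on_def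
  proof (intro ballI impI)
    fix i j :: nat assume "i \<noteq> j"
    then have "B i \<inter> B j = {}"
      using disj by (auto simp: disjoint_family_on_def)
    then show "snd c ` B i \<inter> snd c ` B j = {}"
      using inj_on_image_Int[OF inj_chart[OF c] B(2)[of i] B(2)[of j]] by simp
  qed
  then have "(\<Sum>i. emeasure ?N (snd c ` B i)) = emeasure ?N (\<Union>i. snd c ` B i)"
    using chart_image_borel[OF c B] by (intro suminf_emeasure) auto
  moreover have "(\<Union>i. snd c ` B i) = snd c ` (\<Union>i. B i)"
    by auto
  moreover have "chart_volume c (\<Union>i. B i) = emeasure ?N (snd c ` (\<Union>i. B i))"
    using B by (intro chart_volume_density[OF c]) auto
  ultimately show ?thesis
    by (simp add: chart_volume_density[OF c B])
qed

lemma isometry_bij: "riemannian_isometry A g f \<Longrightarrow> bij f"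
  unfolding riemannian_isometry_def by blast

lemma isometry_inv_smooth:
  "riemannian_isometry A g f \<Longrightarrow> c \<in> A \<Longrightarrow> c' \<in> A \<Longrightarrow>
    smooth_on (snd c ` (fst c \<inter> inv f -` fst c')) (local_rep c c' (inv f))"
  unfolding riemannian_isometry_def smooth_map_def by blast

lemma isometry_image_borel:
  assumes f: "riemannian_isometry A g f" and "E \<in> sets borel"
  shows "f ` E \<in> sets borel"
proof -
  have "inv f \<in> borel_measurable borel"
    using f unfolding riemannian_isometry_def smooth_map_def
    by (intro borel_measurable_continuous_onI) blast
  then have "inv f -` E \<in> sets borel"
    using assms(2) measurable_sets[of "inv f" borel borel E] by simp
  then show ?thesis
    using bij_vimage_eq_inv_image[OF bij_imp_bij_inv[OF isometry_bij[OF f]], of E] isometry_bij[OF f]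
    by (simp add: inv_inv_eq)
qed

text \<open>Change of variables by the local representative \<open>L\<close> of \<open>f\<close>:
  the pullback rule makes its Jacobian factor match the two densities.\<close>

lemma chart_volume_isometry:
  assumes f: "riemannian_isometry A g f" and c: "c \<in> A" "c' \<in> A"
    and E: "E \<in> sets borel" "E \<subseteq> fst c" "f ` E \<subseteq> fst c'"
  shows "chart_volume c' (f ` E) = chart_volume c E"
proof -
  define L where "L = local_rep c c' f"
  define h where "h = local_rep c' c (inv f)"
  let ?S = "snd c ` E" and ?T = "snd c' ` f ` E"
  have inv_f: "inv f (f p) = p" for p
    using isometry_bij[OF f] by (simp add: bij_is_inj)
  have L: "L (snd c p) = snd c' (f p)" if "p \<in> fst c" for p
    using that c by (simp add: L_def local_rep_def)
  have h: "h (snd c' (f p)) = snd c p" if "f p \<in> fst c'" for p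
    using that c by (simp add: h_def local_rep_def inv_f)
  have EE: "p \<in> fst c" "f p \<in> fst c'" if "p \<in> E" for p
    using that E by auto
  have der_L: "(L has_derivative (*v) (jacobian L x)) (at x)" if "x \<in> ?S" for x
    unfolding L_def
    by (rule jacobian_has_derivative, rule smooth_on_differentiable[OF isometry_smooth[OF f c]])
      (use that EE in blast)
  have der_h: "(h has_derivative (*v) (jacobian h y)) (at y)" if "y \<in> ?T" for y
    unfolding h_def
    by (rule jacobian_has_derivative, rule smooth_on_differentiable[OF isometry_inv_smooth[OF f c(2,1)]])
      (use that EE inv_f in \<open>auto intro!: image_eqI\<close>)
  have comp_id: "(*v) (jacobian h y) \<circ> (*v) (jacobian L (h y)) = id" if y: "y \<in> ?T" for y
  proof -
    obtain p where p: "p \<in> E" "y = snd c' (f p)"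
      using y by auto
    have hy: "h y = snd c p" and Lhy: "L (h y) = y"
      using h[of p] L[of p] EE[OF p(1)] p(2) by simp_all
    \<comment> \<open>\<open>E\<close> is only Borel, so the identity
      \<open>h \<circ> L = id\<close> is needed on an open set before it can be
      differentiated.\<close>
    define U where "U = snd c ` fst c \<inter> chart_inv c -` (f -` fst c')"
    have "open (f -` fst c')"
      using isometry_continuous[OF f] open_chart[OF c(2)] by (simp add: open_vimage)
    then have "open U"
      unfolding U_def
      by (intro continuous_open_preimage continuous_chart_inv[OF c(1)] open_chart_image[OF c(1)])
    moreover have "h y \<in> U"
      using EE[OF p(1)] c by (simp add: U_def hy)
    moreover have "(h \<circ> L) x = id x" if x: "x \<in> U" for x
    proof -
      obtain q where q: "q \<in> fst c" "x = snd c q"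
        using x unfolding U_def by blast
      have "f q \<in> fst c'"
        using x q c(1) by (simp add: U_def)
      with q show ?thesis
        using L h by simp
    qed
    ultimately have ev: "\<forall>\<^sub>F x in at (h y). (h \<circ> L) x = id x"
      using eventually_at_topological by blast
    have "((h \<circ> L) has_derivative (*v) (jacobian h y) \<circ> (*v) (jacobian L (h y))) (at (h y))"
      using der_L[of "h y"] der_h[OF y] p(1) by (intro diff_chain_at) (auto simp: hy Lhy[unfolded hy])
    moreover have "((h \<circ> L) has_derivative id) (at (h y))"
      by (rule has_derivative_transform_eventually[OF has_derivative_id]) (use ev Lhy in \<open>auto elim: eventually_mono\<close>)
    ultimately show ?thesis
      by (rule has_derivative_unique)
  qed
  have density_eq: "\<bar>det (matrix ((*v) (jacobian L x)))\<bar> * volume_density c' (L x) = volume_density c x"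
    if x: "x \<in> ?S" for x
  proof -
    obtain p where p: "p \<in> E" "x = snd c p"
      using x by auto
    have "g c p = transpose (jacobian L x) ** g c' (f p) ** jacobian L x"
      unfolding L_def p(2) by (rule isometry_pullback[OF f c EE[OF p(1)]])
    \<comment> \<open>Taking square roots turns the squared determinant into the absolute value of
      the substitution formula.\<close>
    then have "det (g c p) = (det (jacobian L x))\<^sup>2 * det (g c' (f p))"
      by (simp add: det_mul det_transpose power2_eq_square)
    then show ?thesis
      using p EE[OF p(1)] c by (simp add: volume_density_def L real_sqrt_mult)
  qed
  have sub: "?S \<subseteq> snd c ` fst c" "?T \<subseteq> snd c' ` fst c'"
    using E by auto
  have borel: "?S \<in> sets borel" "?T \<in> sets borel"
    using chart_image_borel[OF c(1) E(1,2)] chart_image_borel[OF c(2) isometry_image_borel[OF f E(1)] E(3)] by auto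
  have "chart_volume c' (f ` E) =
      (\<integral>\<^sup>+x\<in>?S. ennreal (\<bar>det (matrix ((*v) (jacobian L x)))\<bar> * volume_density c' (L x)) \<partial>lborel)"
    unfolding chart_volume_def
  proof (rule nn_integral_change_of_variables[where h = h and h' = "\<lambda>y. (*v) (jacobian h y)", OF der_L der_h])
    show "0 \<le> volume_density c' y" if "y \<in> ?T" for y
      using volume_density_pos[OF c(2)] that sub(2) by (meson less_imp_le subsetD)
    show "L x \<in> ?T \<and> h (L x) = x" if "x \<in> ?S" for x
      using that L h EE by auto
    show "h y \<in> ?S \<and> L (h y) = y" if "y \<in> ?T" for y
      using that L h EE by auto
    show "(\<lambda>y. indicator ?T y * volume_density c' y) \<in> borel_measurable borel"
      by (rule volume_density_measurable[OF c(2) borel(2) sub(2)])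
    have "(\<lambda>x. indicator ?S x * (\<bar>det (matrix ((*v) (jacobian L x)))\<bar> * volume_density c' (L x))) =
        (\<lambda>x. indicator ?S x * volume_density c x)"
      using density_eq by (auto simp: fun_eq_iff indicator_def)
    then show "(\<lambda>x. indicator ?S x * (\<bar>det (matrix ((*v) (jacobian L x)))\<bar> * volume_density c' (L x)))
        \<in> borel_measurable borel"
      using volume_density_measurable[OF c(1) borel(1) sub(1)] by simp
  qed (use comp_id in auto)
  also have "\<dots> = chart_volume c E"
    unfolding chart_volume_def using density_eq by (intro nn_integral_cong) (auto simp: indicator_def)
  finally show ?thesis .
qed

section \<open>Gluing the chart volumes to a measure\<close>

definition is_volume :: "'a measure \<Rightarrow> bool" where
  "is_volume M \<longleftrightarrow> sets M = sets borel \<and>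
     (\<forall>c\<in>A. \<forall>B\<in>sets borel. B \<subseteq> fst c \<longrightarrow> emeasure M B = chart_volume c B)"

definition chart_partition :: "(nat \<Rightarrow> ('a, 'n) chart) \<Rightarrow> (nat \<Rightarrow> 'a set) \<Rightarrow> bool" where
  "chart_partition e D \<longleftrightarrow> (\<forall>i. e i \<in> A \<and> D i \<in> sets borel \<and> D i \<subseteq> fst (e i)) \<and>
     disjoint_family D \<and> (\<Union>i. D i) = UNIV"

text \<open>Second countability reduces the atlas to countably many domains, which are then made
  disjoint. If there are finitely many, \<open>from_nat_into\<close> repeats domains, and the
  repetitions contribute empty sets.\<close>

lemma chart_partition_exists: "\<exists>e D. chart_partition e D"
proof -
  have "open S" if "S \<in> fst ` A" for S
    using that open_chart by blast
  from Lindelof[OF this] obtain F where F: "F \<subseteq> fst ` A" "countable F" "\<Union>F = \<Union>(fst ` A)"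
    by blast
  have cover: "\<Union>F = UNIV"
    using F(3) chart_at by auto
  then have "F \<noteq> {}"
    by auto
  have "\<forall>i. \<exists>c\<in>A. fst c = from_nat_into F i"
    using F(1) from_nat_into[OF \<open>F \<noteq> {}\<close>] by force
  then obtain e where e: "\<And>i. e i \<in> A" "\<And>i. fst (e i) = from_nat_into F i"
    by metis
  define D where "D = disjointed (\<lambda>i. fst (e i))"
  have "D i \<in> sets borel" for i
    unfolding D_def using open_chart[OF e(1)]
    by (intro sets.range_disjointed_sets[THEN subsetD, of "\<lambda>i. fst (e i)" borel]) auto
  moreover have "(\<Union>i. D i) = UNIV"
    unfolding D_def UN_disjointed_eq e(2) using cover \<open>F \<noteq> {}\<close> F(2) by (metis range_from_nat_into)
  moreover have "D i \<subseteq> fst (e i)" for i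
    using disjointed_subset[of "\<lambda>i. fst (e i)" i] by (simp add: D_def)
  moreover have "disjoint_family D"
    unfolding D_def by (rule disjoint_family_disjointed)
  ultimately have "chart_partition e D"
    using e(1) by (simp add: chart_partition_def)
  then show ?thesis
    by blast
qed

lemma chart_partitionD:
  assumes "chart_partition e D"
  shows "e i \<in> A" "D i \<in> sets borel" "D i \<subseteq> fst (e i)" "disjoint_family D" "(\<Union>i. D i) = UNIV"
  using assms unfolding chart_partition_def by auto

text \<open>Countable additivity leaves no freedom, which gives uniqueness; the same sum serves as
  the definition of the measure in the existence proof.\<close>

lemma is_volume_emeasure:
  assumes M: "is_volume M" and P: "chart_partition e D" and B: "B \<in> sets borel"
  shows "emeasure M B = (\<Sum>i. chart_volume (e i) (B \<inter> D i))"
proof -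
  note P = chart_partitionD[OF P]
  have "disjoint_family (\<lambda>i. B \<inter> D i)"
    using P(4) unfolding disjoint_family_on_def by blast
  then have "(\<Sum>i. emeasure M (B \<inter> D i)) = emeasure M (\<Union>i. B \<inter> D i)"
    using M P(2) B by (intro suminf_emeasure) (auto simp: is_volume_def)
  moreover have "(\<Union>i. B \<inter> D i) = B"
    using P(5) by auto
  moreover have "emeasure M (B \<inter> D i) = chart_volume (e i) (B \<inter> D i)" for i
    using M P(1,2,3)[of i] B unfolding is_volume_def by (metis inf.coboundedI2 sets.Int)
  ultimately show ?thesis
    by simp
qed

lemma is_volume_unique:
  assumes "is_volume M" "is_volume M'"
  shows "M = M'"
proof -
  obtain e D where "chart_partition e D"
    using chart_partition_exists by blast
  then show ?thesis
    using assms is_volume_emeasure[of _ e D]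
    by (intro measure_eqI) (auto simp: is_volume_def)
qed

lemma isometry_vimage_borel:
  assumes "riemannian_isometry A g f" "B \<in> sets borel"
  shows "f -` B \<in> sets borel"
  using measurable_sets[OF borel_measurable_continuous_onI[OF isometry_continuous[OF assms(1)]] assms(2)]
  by simp

text \<open>Each piece may be moved from its own chart \<open>e i\<close> to \<open>c\<close> by
  \<open>chart_volume_isometry\<close>, and the pieces then add up inside \<open>c\<close>. With
  \<open>f = id\<close> this gives existence of the volume, with other \<open>f\<close> its
  invariance.\<close>

lemma chart_volume_partition:
  assumes f: "riemannian_isometry A g f" and P: "chart_partition e D"
    and c: "c \<in> A" and B: "B \<in> sets borel" "B \<subseteq> fst c"
  shows "(\<Sum>i. chart_volume (e i) (f -` B \<inter> D i)) = chart_volume c B"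
proof -
  note P = chart_partitionD[OF P]
  let ?B = "\<lambda>i. f ` (f -` B \<inter> D i)"
  have meas: "f -` B \<inter> D i \<in> sets borel" for i
    using isometry_vimage_borel[OF f B(1)] P(2) by auto
  have "chart_volume (e i) (f -` B \<inter> D i) = chart_volume c (?B i)" for i
    using meas P(3)[of i] B(2) by (intro chart_volume_isometry[OF f P(1) c, symmetric]) auto
  moreover have "disjoint_family ?B"
    unfolding disjoint_family_on_def
  proof (intro ballI impI)
    fix i j :: nat assume "i \<noteq> j"
    then have "D i \<inter> D j = {}"
      using P(4) by (auto simp: disjoint_family_on_def)
    then show "?B i \<inter> ?B j = {}"
      using bij_is_inj[OF isometry_bij[OF f]] by (auto simp: inj_eq)
  qed
  then have "(\<Sum>i. chart_volume c (?B i)) = chart_volume c (\<Union>i. ?B i)"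
    using isometry_image_borel[OF f meas] B(2) by (intro chart_volume_suminf[OF c]) auto
  moreover have "(\<Union>i. ?B i) = B"
  proof -
    have "(\<Union>i. ?B i) = f ` (f -` B \<inter> (\<Union>i. D i))"
      by blast
    also have "\<dots> = B"
      using P(5) bij_is_surj[OF isometry_bij[OF f]] by (simp add: surj_image_vimage_eq)
    finally show ?thesis .
  qed
  ultimately show ?thesis
    by simp
qed

lemma is_volume_exists: "\<exists>M. is_volume M"
proof -
  obtain e D where ch: "chart_partition e D"
    using chart_partition_exists by blast
  note P = chart_partitionD[OF ch]
  define \<nu> where "\<nu> B = (\<Sum>i. chart_volume (e i) (B \<inter> D i))" for B
  define M where "M = measure_of UNIV (sets borel) \<nu>"
  have alg: "sigma_algebra UNIV (sets (borel :: 'a measure))"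
    using sets.sigma_algebra_axioms[of borel] by simp
  have sets: "sets M = sets borel"
    unfolding M_def using sets.sigma_sets_eq[of borel] by simp
  have "countably_additive (sets borel) \<nu>"
    unfolding countably_additive_def
  proof (intro allI impI)
    fix B :: "nat \<Rightarrow> 'a set" assume B: "range B \<subseteq> sets borel" and disj: "disjoint_family B"
    \<comment> \<open>The double series is exchanged by reading the sum over \<open>i\<close> as an
      integral against counting measure.\<close>
    have "(\<Sum>j. \<nu> (B j)) = (\<Sum>j. \<integral>\<^sup>+i. chart_volume (e i) (B j \<inter> D i) \<partial>count_space UNIV)"
      by (simp add: \<nu>_def nn_integral_count_space_nat)
    also have "\<dots> = (\<integral>\<^sup>+i. (\<Sum>j. chart_volume (e i) (B j \<inter> D i)) \<partial>count_space UNIV)"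
      by (rule nn_integral_suminf[symmetric]) simp
    also have "\<dots> = (\<Sum>i. \<Sum>j. chart_volume (e i) (B j \<inter> D i))"
      by (rule nn_integral_count_space_nat)
    also have "\<dots> = (\<Sum>i. chart_volume (e i) ((\<Union>j. B j) \<inter> D i))"
    proof (intro suminf_cong)
      fix i
      have "disjoint_family (\<lambda>j. B j \<inter> D i)"
        using disj unfolding disjoint_family_on_def by blast
      then have "(\<Sum>j. chart_volume (e i) (B j \<inter> D i)) = chart_volume (e i) (\<Union>j. B j \<inter> D i)"
        using B P(1,2,3)[of i] by (intro chart_volume_suminf) auto
      then show "(\<Sum>j. chart_volume (e i) (B j \<inter> D i)) = chart_volume (e i) ((\<Union>j. B j) \<inter> D i)"
        by simp
    qed
    finally show "(\<Sum>j. \<nu> (B j)) = \<nu> (\<Union>j. B j)"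
      by (simp add: \<nu>_def)
  qed
  moreover have "positive (sets borel) \<nu>"
    by (simp add: positive_def \<nu>_def chart_volume_def)
  ultimately have em: "emeasure M B = \<nu> B" if "B \<in> sets borel" for B
    unfolding M_def by (intro emeasure_measure_of_sigma[OF alg] that)
  \<comment> \<open>The sum was formed with one chosen partition, yet it has the right value in
    every chart of the atlas.\<close>
  have "\<nu> B = chart_volume c B" if "c \<in> A" "B \<in> sets borel" "B \<subseteq> fst c" for c B
    using chart_volume_partition[OF riemannian_isometry_id ch that] by (simp add: \<nu>_def)
  then have "is_volume M"
    using em sets by (simp add: is_volume_def)
  then show ?thesis
    by blast
qed

abbreviation vol :: "'a measure" where
  "vol \<equiv> riemannian_volume A g"

lemma is_volume_riemannian_volume: "is_volume vol"
proof -
  have "vol = (THE M. is_volume M)"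
    unfolding riemannian_volume_def is_volume_def chart_volume_def volume_density_def ..
  moreover have "is_volume (THE M. is_volume M)"
    using is_volume_exists is_volume_unique by (blast intro: theI')
  ultimately show ?thesis
    by simp
qed

lemma sets_riemannian_volume [measurable_cong]: "sets vol = sets borel"
  and emeasure_riemannian_volume:
    "c \<in> A \<Longrightarrow> B \<in> sets borel \<Longrightarrow> B \<subseteq> fst c \<Longrightarrow> emeasure vol B = chart_volume c B"
  using is_volume_riemannian_volume unfolding is_volume_def by auto

lemma space_riemannian_volume: "space vol = UNIV"
  using sets_eq_imp_space_eq[OF sets_riemannian_volume] by simp

text \<open>The image measure has the property that characterises the volume, so uniqueness
  identifies the two.\<close>

lemma distr_isometry_riemannian_volume:
  assumes f: "riemannian_isometry A g f"
  shows "distr vol borel f = vol"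
proof (rule is_volume_unique[OF _ is_volume_riemannian_volume])
  obtain e D where ch: "chart_partition e D"
    using chart_partition_exists by blast
  have meas: "f \<in> measurable vol borel"
    using borel_measurable_continuous_onI[OF isometry_continuous[OF f]]
    by (simp add: measurable_cong_sets[OF sets_riemannian_volume refl])
  show "is_volume (distr vol borel f)"
    unfolding is_volume_def
  proof (intro conjI ballI impI)
    fix c B assume c: "c \<in> A" and B: "B \<in> sets borel" "B \<subseteq> fst c"
    have "emeasure (distr vol borel f) B = emeasure vol (f -` B)"
      using meas B(1) by (simp add: emeasure_distr space_riemannian_volume)
    also have "\<dots> = (\<Sum>i. chart_volume (e i) (f -` B \<inter> D i))"
      by (rule is_volume_emeasure[OF is_volume_riemannian_volume ch isometry_vimage_borel[OF f B(1)]])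
    also have "\<dots> = chart_volume c B"
      by (rule chart_volume_partition[OF f ch c B])
    finally show "emeasure (distr vol borel f) B = chart_volume c B" .
  qed simp
qed

section \<open>Points are null; local finiteness and positivity of the volume\<close>

lemma riemannian_volume_singleton: "emeasure vol {p} = 0"
proof -
  obtain c where c: "c \<in> A" "p \<in> fst c"
    using chart_at by blast
  then have "emeasure vol {p} = chart_volume c {p}"
    by (intro emeasure_riemannian_volume) auto
  then show ?thesis
    by (simp add: chart_volume_def)
qed

text \<open>The density is bounded on a closed coordinate ball, and Euclidean balls have finite
  measure. A finite subcover will then bound the total volume.\<close>

lemma riemannian_volume_locally_finite:
  "\<exists>U. open U \<and> p \<in> U \<and> emeasure vol U < \<infinity>"
proof -
  obtain c where c: "c \<in> A" "p \<in> fst c"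
    using chart_at by blast
  obtain r where r: "r > 0" "cball (snd c p) r \<subseteq> snd c ` fst c"
    using chart_cball[OF c open_UNIV UNIV_I] by auto
  have "bounded (volume_density c ` cball (snd c p) r)"
    by (intro compact_imp_bounded compact_continuous_image compact_cball
        continuous_on_subset[OF continuous_on_volume_density[OF c(1)] r(2)])
  then obtain C where C: "\<forall>y\<in>volume_density c ` cball (snd c p) r. norm y \<le> C"
    unfolding bounded_iff by (elim exE)
  define U where "U = fst c \<inter> snd c -` ball (snd c p) r"
  have "open U"
    unfolding U_def by (rule open_chart_ball[OF c(1)])
  have "emeasure vol U = chart_volume c U"
    using \<open>open U\<close> c by (intro emeasure_riemannian_volume) (auto simp: U_def)
  also have "\<dots> \<le> (\<integral>\<^sup>+x. ennreal C * indicator (ball (snd c p) r) x \<partial>lborel)"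
    unfolding chart_volume_def
  proof (intro nn_integral_mono)
    fix x
    show "ennreal (volume_density c x) * indicator (snd c ` U) x \<le> ennreal C * indicator (ball (snd c p) r) x"
    proof (cases "x \<in> snd c ` U")
      case True
      then have x: "x \<in> ball (snd c p) r"
        by (auto simp: U_def)
      then have "x \<in> cball (snd c p) r"
        by simp
      then have "norm (volume_density c x) \<le> C"
        using C by blast
      then have "volume_density c x \<le> C"
        by simp
      then show ?thesis
        using True x by (simp add: ennreal_leI)
    qed simp
  qed
  also have "\<dots> = ennreal C * emeasure lborel (ball (snd c p) r)"
    by (simp add: nn_integral_cmult_indicator)
  also have "\<dots> < \<infinity>"
    using emeasure_lborel_ball_finite[of "snd c p" r] by (simp add: ennreal_mult_less_top)
  finally show ?thesis
    using \<open>open U\<close> c(2) r(1) by (intro exI[of _ U]) (simp add: U_def)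
qed

text \<open>A positive density over a nonempty open set of coordinates has positive integral. This
  keeps the denominator of the weight measure away from 0.\<close>

lemma riemannian_volume_positive: "0 < emeasure vol UNIV"
proof -
  obtain c and p :: 'a where c: "c \<in> A" "p \<in> fst c"
    using chart_at by blast
  let ?U = "snd c ` fst c"
  have borel: "?U \<in> sets borel"
    using open_chart_image[OF c(1)] by simp
  have "chart_volume c (fst c) \<noteq> 0"
  proof
    assume "chart_volume c (fst c) = 0"
    moreover have "chart_volume c (fst c) = (\<integral>\<^sup>+x. ennreal (indicator ?U x * volume_density c x) \<partial>lborel)"
      unfolding chart_volume_def by (intro nn_integral_cong) (auto simp: indicator_def)
    ultimately have "AE x in lborel. ennreal (indicator ?U x * volume_density c x) = 0"
      using volume_density_measurable[OF c(1) borel order_refl] by (simp add: nn_integral_0_iff_AE)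
    then have "AE x in lborel. x \<notin> ?U"
      by eventually_elim
        (use volume_density_pos[OF c(1)] in \<open>fastforce simp: indicator_def ennreal_eq_0_iff not_le\<close>)
    then have "?U \<in> null_sets lborel"
      using borel by (subst AE_iff_null_sets) auto
    then have "negligible ?U"
      using negligible_iff_null_sets null_sets_completionI by blast
    then show False
      using open_not_negligible[OF open_chart_image[OF c(1)]] c(2) by auto
  qed
  then have "0 < emeasure vol (fst c)"
    using emeasure_riemannian_volume[OF c(1) _ order_refl] open_chart[OF c(1)]
    by (simp add: zero_less_iff_neq_zero)
  also have "\<dots> \<le> emeasure vol UNIV"
    by (intro emeasure_mono) (auto simp: sets_riemannian_volume)
  finally show ?thesis .
qed

end

context compact_riemannian
begin

lemma finite_riemannian_volume: "finite_measure vol"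
proof
  define \<U> where "\<U> = {U. open U \<and> emeasure vol U < \<infinity>}"
  have cover: "UNIV \<subseteq> \<Union>\<U>"
    using riemannian_volume_locally_finite by (auto simp: \<U>_def)
  have "open U" if "U \<in> \<U>" for U
    using that by (simp add: \<U>_def)
  from compactE[OF compact cover this] obtain F where F: "F \<subseteq> \<U>" "finite F" "UNIV \<subseteq> \<Union>F"
    by metis
  have "emeasure vol (\<Union>U\<in>F. U) \<le> (\<Sum>U\<in>F. emeasure vol U)"
    using F by (intro emeasure_subadditive_finite) (auto simp: \<U>_def sets_riemannian_volume)
  also have "\<dots> < \<infinity>"
    using F by (auto simp: \<U>_def)
  finally have "emeasure vol (\<Union>U\<in>F. U) < \<infinity>" .
  moreover have "(\<Union>U\<in>F. U) = UNIV"
    using F(3) by auto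
  ultimately show "emeasure vol (space vol) \<noteq> \<infinity>"
    by (simp add: space_riemannian_volume)
qed

end

section \<open>The weight measure\<close>

context compact_riemannian
begin

lemma riemannian_dist_measurable: "case_prod d \<in> borel_measurable borel"
proof -
  have "(\<lambda>z. d (fst z) (snd z)) \<in> borel_measurable borel"
    by (rule borel_measurable_continuous_onI[OF continuous_on_riemannian_dist])
  then show ?thesis
    by (simp add: case_prod_beta')
qed

lemma exp_dist_measurable: "(\<lambda>x. exp (- d x y)) \<in> borel_measurable vol"
proof -
  have "(\<lambda>x. exp (- d x y)) \<in> borel_measurable borel"
    by (intro borel_measurable_continuous_onI continuous_intros)
  then show ?thesis
    by (simp add: measurable_cong_sets[OF sets_riemannian_volume refl])
qed

lemma exp_dist_integrable: "integrable vol (\<lambda>x. exp (- d x y))"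
proof -
  interpret finite_measure vol
    by (rule finite_riemannian_volume)
  show ?thesis
    by (rule integrable_const_bound[of _ 1])
      (simp_all add: exp_dist_measurable riemannian_dist_nonneg)
qed

lemma weight_denom_pos: "0 < weight_denom A g y"
proof -
  have "weight_denom A g y \<noteq> 0"
  proof
    assume "weight_denom A g y = 0"
    then have "AE x in vol. exp (- d x y) = 0"
      unfolding weight_denom_def
      by (subst (asm) integral_nonneg_eq_0_iff_AE) (simp_all add: exp_dist_integrable)
    \<comment> \<open>The exponential never vanishes, so the almost everywhere statement says that
      the whole space is null.\<close>
    then have "emeasure vol UNIV = 0"
      using AE_iff_measurable[of UNIV vol "\<lambda>_. False"]
      by (simp add: space_riemannian_volume sets_riemannian_volume)
    then show False
      using riemannian_volume_positive by simp
  qed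
  moreover have "0 \<le> weight_denom A g y"
    unfolding weight_denom_def by (intro integral_nonneg_AE) simp
  ultimately show ?thesis
    by simp
qed

text \<open>Isometries do not increase distances, so homogeneity yields this inequality in both directions.\<close>

lemma weight_denom_isometry_le:
  assumes f: "riemannian_isometry A g f"
  shows "weight_denom A g y \<le> weight_denom A g (f y)"
proof -
  have meas: "f \<in> measurable vol borel"
    using borel_measurable_continuous_onI[OF isometry_continuous[OF f]]
    by (simp add: measurable_cong_sets[OF sets_riemannian_volume refl])
  have h: "(\<lambda>x. exp (- d x (f y))) \<in> borel_measurable borel"
    by (intro borel_measurable_continuous_onI continuous_intros)
  have "weight_denom A g (f y) = (LINT x|distr vol borel f. exp (- d x (f y)))"
    by (simp add: weight_denom_def distr_isometry_riemannian_volume[OF f])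
  also have "\<dots> = (LINT x|vol. exp (- d (f x) (f y)))"
    by (rule integral_distr[OF meas h])
  also have "weight_denom A g y \<le> \<dots>"
    unfolding weight_denom_def
  proof (rule integral_mono[OF exp_dist_integrable])
    have "integrable (distr vol borel f) (\<lambda>x. exp (- d x (f y)))"
      by (simp add: distr_isometry_riemannian_volume[OF f] exp_dist_integrable)
    then show "integrable vol (\<lambda>x. exp (- d (f x) (f y)))"
      by (rule integrable_distr[OF meas])
    show "exp (- d x y) \<le> exp (- d (f x) (f y))" for x
      using riemannian_dist_isometry_le[OF f] by simp
  qed
  finally show ?thesis .
qed

lemma geodesics_riemannian_dist:
  assumes "x \<noteq> y"
  shows "geodesics d x y \<noteq> {}"
proof (rule geodesics_nonempty[OF compact _ riemannian_dist_eq_0_iff riemannian_dist_sym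
      riemannian_dist_triangle riemannian_dist_between assms])
  show "continuous_on UNIV (\<lambda>p. d p q)" for q
    by (intro continuous_intros)
qed

text \<open>By \<open>hom\<close> the weight measure has potential 1 at every point and not just at
  \<open>y\<close>; scaling by \<open>c\<close> makes it \<open>c\<close>.\<close>

lemma magnitude_upto_scaled_weight:
  fixes y :: 'a and c :: real
  assumes hom: "\<And>y y'. weight_denom A g y = weight_denom A g y'" and "0 \<le> c"
  defines "\<mu> \<equiv> weight_measure A g y"
  shows "magnitude_upto d (scale_measure (ennreal c) \<mu>) (triv_measure d) N =
    c * measure \<mu> UNIV * (\<Sum>n\<le>N. (- c) ^ n)"
proof -
  define M where "M = scale_measure (ennreal c) \<mu>"
  define W where "W = weight_denom A g y"
  have W: "0 < W"
    unfolding W_def by (rule weight_denom_pos)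
  \<comment> \<open>Both normalisations are merged into a single factor, so that finiteness and null
    points are inherited from the volume.\<close>
  have scale: "M = scale_measure (ennreal (c / W)) vol"
    using \<open>0 \<le> c\<close> W unfolding M_def \<mu>_def weight_measure_def W_def[symmetric]
    by (simp add: ennreal_mult[symmetric])
  have sets: "sets M = sets borel"
    by (simp add: scale sets_riemannian_volume)
  interpret V: finite_measure vol
    by (rule finite_riemannian_volume)
  have fin: "finite_measure M"
    by (rule finite_measureI) (simp add: scale space_scale_measure ennreal_mult_eq_top_iff)
  \<comment> \<open>Second countability identifies the product of the Borel sets with the Borel sets
    of the product, where continuity of \<open>d\<close> gives measurability.\<close>
  have sets2: "sets (M \<Otimes>\<^sub>M M) = sets (borel :: ('a \<times> 'a) measure)"
    by (simp only: sets_pair_measure_cong[OF sets sets] borel_prod)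
  have meas: "case_prod d \<in> borel_measurable (M \<Otimes>\<^sub>M M)"
    using riemannian_dist_measurable by (simp only: measurable_cong_sets[OF sets2 refl])
  have total: "(\<integral>\<^sup>+z. ennreal (exp (- d x z)) \<partial>M) = ennreal c" for x
  proof -
    \<comment> \<open>\<open>weight_denom\<close> integrates over the first argument of
      \<open>d\<close>, the potential over the second; symmetry reconciles them.\<close>
    have "(\<integral>\<^sup>+z. ennreal (exp (- d x z)) \<partial>M) = ennreal (c / W) * (\<integral>\<^sup>+z. ennreal (exp (- d z x)) \<partial>vol)"
      unfolding scale riemannian_dist_sym[of x]
      by (intro nn_integral_scale_measure) (use exp_dist_measurable in simp)
    also have "(\<integral>\<^sup>+z. ennreal (exp (- d z x)) \<partial>vol) = ennreal (weight_denom A g x)"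
      unfolding weight_denom_def by (rule nn_integral_eq_integral[OF exp_dist_integrable]) simp
    also have "weight_denom A g x = W"
      unfolding W_def by (rule hom)
    finally show ?thesis
      using W \<open>0 \<le> c\<close> by (simp add: ennreal_mult[symmetric])
  qed
  have "magnitude_upto d M (triv_measure d) N = measure M UNIV * (\<Sum>n\<le>N. (- c) ^ n)"
    using sets fin _ meas riemannian_dist_eq_0_iff total \<open>0 \<le> c\<close> geodesics_riemannian_dist
    by (rule magnitude_upto_weight) (simp add: scale riemannian_volume_singleton)
  moreover have "measure M UNIV = c * measure \<mu> UNIV"
    using \<open>0 \<le> c\<close> by (simp add: M_def measure_scale_measure)
  ultimately show ?thesis
    by (simp add: M_def)
qed

end

lemma sum_minus_one_power: "(\<Sum>n\<le>N. (- 1 :: real) ^ n) = (if even N then 1 else 0)"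
  by (induction N) auto

theorem corollary5p6:
  fixes A :: "('a::{t2_space,second_countable_topology}, 'n::finite) chart set"
    and g :: "('a, 'n) metric_tensor"
  assumes "smooth_atlas A"
    and "riemannian_metric A g"
    and "compact (UNIV :: 'a set)"
    and "connected (UNIV :: 'a set)"
    and "homogeneous A g"
  shows "(\<forall>y y'. weight_denom A g y = weight_denom A g y') \<and>
    (\<forall>y. let d = riemannian_dist A g; \<mu> = weight_measure A g y; \<Gamma> = triv_measure d in
       (\<forall>N>0. magnitude_upto d \<mu> \<Gamma> N = (if even N then measure \<mu> UNIV else 0)) \<and>
       measure \<mu> UNIV = measure (riemannian_volume A g) UNIV / weight_denom A g y \<and>
       (\<forall>c::real. 0 < c \<and> c < 1 \<longrightarrow>
          has_magnitude d (scale_measure (ennreal c) \<mu>) \<Gamma> (ereal (c / (1 + c) * measure \<mu> UNIV))))"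
proof -
  interpret compact_riemannian A g
    using assms by unfold_locales
  have hom: "weight_denom A g y = weight_denom A g y'" for y y'
  proof (rule antisym)
    \<comment> \<open>Homogeneity supplies an isometry taking \<open>y\<close> to \<open>y'\<close>.
      The inequality holds for all pairs, so the reverse one is an instance.\<close>
    show "weight_denom A g y \<le> weight_denom A g y'" for y y'
      using \<open>homogeneous A g\<close> weight_denom_isometry_le unfolding homogeneous_def by metis
    then show "weight_denom A g y' \<le> weight_denom A g y" .
  qed
  have "let d = riemannian_dist A g; \<mu> = weight_measure A g y; \<Gamma> = triv_measure d in
       (\<forall>N>0. magnitude_upto d \<mu> \<Gamma> N = (if even N then measure \<mu> UNIV else 0)) \<and>
       measure \<mu> UNIV = measure (riemannian_volume A g) UNIV / weight_denom A g y \<and>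
       (\<forall>c::real. 0 < c \<and> c < 1 \<longrightarrow>
          has_magnitude d (scale_measure (ennreal c) \<mu>) \<Gamma> (ereal (c / (1 + c) * measure \<mu> UNIV)))" for y
    unfolding Let_def
  proof (intro conjI allI impI)
    let ?\<mu> = "weight_measure A g y"
    fix N :: nat
    show "magnitude_upto d ?\<mu> (triv_measure d) N = (if even N then measure ?\<mu> UNIV else 0)"
      \<comment> \<open>With \<open>c = 1\<close> the geometric sum alternates between 1 and
        0.\<close>
      using magnitude_upto_scaled_weight[OF hom, of 1 y N] by (simp add: sum_minus_one_power)
  next
    show "measure (weight_measure A g y) UNIV = measure vol UNIV / weight_denom A g y"
      using weight_denom_pos[of y] by (simp add: weight_measure_def measure_scale_measure)
  next
    let ?\<mu> = "weight_measure A g y"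
    fix c :: real assume c: "0 < c \<and> c < 1"
    \<comment> \<open>The ratio is \<open>- c\<close>, so convergence is where \<open>c < 1\<close>
      is needed, and the limit has denominator \<open>1 + c\<close>.\<close>
    have "(\<lambda>n. (- c) ^ n) sums (1 / (1 - (- c)))"
      using c by (intro geometric_sums) simp
    then have "(\<lambda>N. c * measure ?\<mu> UNIV * (\<Sum>n\<le>N. (- c) ^ n)) \<longlonglongrightarrow> c * measure ?\<mu> UNIV * (1 / (1 + c))"
      unfolding sums_def_le by (intro tendsto_intros) simp
    then show "has_magnitude d (scale_measure (ennreal c) ?\<mu>) (triv_measure d)
        (ereal (c / (1 + c) * measure ?\<mu> UNIV))"
      using c unfolding has_magnitude_def magnitude_upto_scaled_weight[OF hom less_imp_le[OF conjunct1[OF c]]]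
      by (simp add: mult_ac)
  qed
  then show ?thesis
    using hom by blast
qed

end
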